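(* No $K_4$-minor-free graph is ugly, and a good connected ordering of any connected $K_4$-minor-free graph can be computed in polynomial time. That is, for every connected graph $G$ not having $K_4$ as a minor there is a connected ordering $\sigma$ of $V(G)$ such that the greedy colouring relative to $\sigma$ uses exactly $\chi(G)$ colours, and such an ordering can be computed in time polynomial in the size of $G$.
   Context: Graphs are finite and simple. Given an ordering $\sigma: v_1,\dots,v_n$ of the vertices of $G$, the greedy colouring relative to $\sigma$ colours $v_1,\dots,v_n$ in this order, assigning to each vertex the smallest positive integer not used by its already coloured neighbours; $\chi(G,\sigma)$ denotes the number of colours used. An ordering $v_1,\dots,v_n$ is connected if for every $i$ the subgraph induced by $v_1,\dots,v_i$ is connected. For a connected graph $G$, $\chi_c(G)$ is the minimum of $\chi(G,\sigma)$ over all connected orderings $\sigma$; a connected graph is ugly if $\chi_c(G)>\chi(G)$. A good connected ordering of a connected graph $G$ is a connected ordering $\sigma$ with $\chi(G,\sigma)=\chi(G)$. A graph $H$ is a minor of $G$ if $H$ can be obtained from $G$ by vertex deletions, edge deletions and edge contractions. *)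

theory Defs
  imports "Graph_Theory.Graph_Theory" "HOL-Computational_Algebra.Polynomial"
begin

section \<open>Graphs, minors and connected greedy colourings\<close>

text \<open>
  A finite simple graph is a \<open>pair_graph\<close>: a finite, loopless, symmetric digraph whose arcs are
  pairs of vertices, so that every edge is represented by its two arcs.
  The library's \<open>connected\<close> (here qualified because of the topological notion of the same name)
  requires a nonempty vertex set.
\<close>

type_synonym 'a sgraph = "'a pair_pre_digraph"

abbreviation connected_graph :: "'a sgraph \<Rightarrow> bool" where
  "connected_graph G \<equiv> Digraph_Component.connected (with_proj G)"

definition delete_vertex :: "'a sgraph \<Rightarrow> 'a \<Rightarrow> 'a sgraph" where
  "delete_vertex G v =
     \<lparr> pverts = pverts G - {v}, parcs = {(x, y) \<in> parcs G. x \<noteq> v \<and> y \<noteq> v} \<rparr>"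

definition delete_edge :: "'a sgraph \<Rightarrow> 'a \<Rightarrow> 'a \<Rightarrow> 'a sgraph" where
  "delete_edge G u v = \<lparr> pverts = pverts G, parcs = parcs G - {(u, v), (v, u)} \<rparr>"

text \<open>The contracted edge becomes the vertex \<open>u\<close>; loops and parallel edges are discarded.\<close>

definition contract_edge :: "'a sgraph \<Rightarrow> 'a \<Rightarrow> 'a \<Rightarrow> 'a sgraph" where
  "contract_edge G u v =
     (let f = (\<lambda>w. if w = v then u else w)
      in \<lparr> pverts = pverts G - {v},
           parcs = {(f x, f y) | x y. (x, y) \<in> parcs G \<and> f x \<noteq> f y} \<rparr>)"

inductive minor_step :: "'a sgraph \<Rightarrow> 'a sgraph \<Rightarrow> bool" where
  "v \<in> pverts G \<Longrightarrow> minor_step G (delete_vertex G v)"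
| "(u, v) \<in> parcs G \<Longrightarrow> minor_step G (delete_edge G u v)"
| "(u, v) \<in> parcs G \<Longrightarrow> minor_step G (contract_edge G u v)"

definition K4_minor_free :: "'a sgraph \<Rightarrow> bool" where
  "K4_minor_free G \<longleftrightarrow> \<not> (\<exists>H. minor_step\<^sup>*\<^sup>* G H \<and> complete_digraph 4 (with_proj H))"

definition chromatic_number :: "'a sgraph \<Rightarrow> nat" where
  "chromatic_number G =
     (LEAST k. \<exists>c. c ` pverts G \<subseteq> {1..k} \<and> (\<forall>(u, v) \<in> parcs G. c u \<noteq> c v))"

definition ordering :: "'a sgraph \<Rightarrow> 'a list \<Rightarrow> bool" where
  "ordering G \<sigma> \<longleftrightarrow> distinct \<sigma> \<and> set \<sigma> = pverts G"

definition connected_ordering :: "'a sgraph \<Rightarrow> 'a list \<Rightarrow> bool" where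
  "connected_ordering G \<sigma> \<longleftrightarrow> ordering G \<sigma> \<and>
     (\<forall>i \<in> {1..length \<sigma>}. Digraph_Component.connected (with_proj G \<restriction> set (take i \<sigma>)))"

definition greedy_step :: "'a sgraph \<Rightarrow> ('a \<rightharpoonup> nat) \<Rightarrow> 'a \<Rightarrow> ('a \<rightharpoonup> nat)" where
  "greedy_step G c v = c(v \<mapsto> (LEAST k. 1 \<le> k \<and> (\<forall>u. (u, v) \<in> parcs G \<longrightarrow> c u \<noteq> Some k)))"

definition greedy_colouring :: "'a sgraph \<Rightarrow> 'a list \<Rightarrow> ('a \<rightharpoonup> nat)" where
  "greedy_colouring G \<sigma> = foldl (greedy_step G) Map.empty \<sigma>"

definition greedy_number :: "'a sgraph \<Rightarrow> 'a list \<Rightarrow> nat" where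
  "greedy_number G \<sigma> = card (ran (greedy_colouring G \<sigma>))"

definition connected_greedy_number :: "'a sgraph \<Rightarrow> nat" where
  "connected_greedy_number G = (LEAST k. \<exists>\<sigma>. connected_ordering G \<sigma> \<and> greedy_number G \<sigma> = k)"

definition ugly :: "'a sgraph \<Rightarrow> bool" where
  "ugly G \<longleftrightarrow> connected_graph G \<and> connected_greedy_number G > chromatic_number G"

definition good_connected_ordering :: "'a sgraph \<Rightarrow> 'a list \<Rightarrow> bool" where
  "good_connected_ordering G \<sigma> \<longleftrightarrow>
     connected_ordering G \<sigma> \<and> greedy_number G \<sigma> = chromatic_number G"


section \<open>Polynomial time\<close>

text \<open>
  The machine model is a structured random access machine over the natural numbers. Its memory
  consists of unboundedly long arrays (a program mentions only finitely many of them); a scalar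
  variable is cell 0 of an array. The only arithmetic is addition and truncated subtraction, and
  every command and every test costs one time unit. Expressions of a fixed program have bounded
  size, so each step lengthens the binary representation of the largest number in use by at most a
  constant number of bits. Hence unit cost is polynomially related to logarithmic cost and to
  Turing machine time. (This would fail with multiplication at unit cost.)
\<close>

type_synonym store = "string \<Rightarrow> nat \<Rightarrow> nat"

datatype aexp = Const nat | Cell string aexp | Plus aexp aexp | Minus aexp aexp

datatype bexp = Less aexp aexp | Neg bexp | Conj bexp bexp

datatype com =
    Skip
  | Assign string aexp aexp
  | Seq com com
  | Cond bexp com com
  | While bexp com

fun aval :: "aexp \<Rightarrow> store \<Rightarrow> nat" where
  "aval (Const n) s = n"
| "aval (Cell x a) s = s x (aval a s)"
| "aval (Plus a b) s = aval a s + aval b s"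
| "aval (Minus a b) s = aval a s - aval b s"

fun bval :: "bexp \<Rightarrow> store \<Rightarrow> bool" where
  "bval (Less a b) s \<longleftrightarrow> aval a s < aval b s"
| "bval (Neg b) s \<longleftrightarrow> \<not> bval b s"
| "bval (Conj b c) s \<longleftrightarrow> bval b s \<and> bval c s"

text \<open>\<open>exec c s t s'\<close>: started in store \<open>s\<close>, program \<open>c\<close> halts after \<open>t\<close> steps in store \<open>s'\<close>.\<close>

inductive exec :: "com \<Rightarrow> store \<Rightarrow> nat \<Rightarrow> store \<Rightarrow> bool" where
  Skip: "exec Skip s 1 s"
| Assign: "exec (Assign x i a) s 1 (s(x := (s x)(aval i s := aval a s)))"
| Seq: "exec c s t s' \<Longrightarrow> exec d s' t' s'' \<Longrightarrow> exec (Seq c d) s (t + t') s''"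
| CondTrue: "bval b s \<Longrightarrow> exec c s t s' \<Longrightarrow> exec (Cond b c d) s (1 + t) s'"
| CondFalse: "\<not> bval b s \<Longrightarrow> exec d s t s' \<Longrightarrow> exec (Cond b c d) s (1 + t) s'"
| WhileFalse: "\<not> bval b s \<Longrightarrow> exec (While b c) s 1 s"
| WhileTrue: "bval b s \<Longrightarrow> exec c s t s' \<Longrightarrow> exec (While b c) s' t' s'' \<Longrightarrow>
    exec (While b c) s (1 + t + t') s''"

text \<open>
  A graph on the vertices \<open>0, \<dots>, n - 1\<close> is presented by \<open>n\<close> together with its adjacency matrix,
  stored row by row; all other cells are 0. An ordering of the vertices is returned in the first
  \<open>n\<close> cells of the array \<open>out\<close>.
\<close>

definition graph_store :: "nat \<Rightarrow> nat sgraph \<Rightarrow> store" where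
  "graph_store n G = (\<lambda>_ _. 0)
     (''n'' := (\<lambda>_. 0)(0 := n),
      ''adj'' := (\<lambda>i. if (i div n, i mod n) \<in> parcs G then 1 else 0))"

definition output_list :: "nat \<Rightarrow> store \<Rightarrow> nat list" where
  "output_list n s = map (s ''out'') [0..<n]"

text \<open>
  A program is only constrained on graphs satisfying the promise \<open>P\<close>. Its running time is bounded
  by a polynomial in the number \<open>n\<close> of vertices; a bound in terms of vertices and edges is the
  same, there being at most \<open>n\<^sup>2\<close> edges.
\<close>

definition poly_time_ordering ::
    "(nat sgraph \<Rightarrow> bool) \<Rightarrow> (nat sgraph \<Rightarrow> nat list \<Rightarrow> bool) \<Rightarrow> bool" where
  "poly_time_ordering P R \<longleftrightarrow>
     (\<exists>(c :: com) (p :: nat poly). \<forall>n G.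
        pair_graph G \<and> pverts G = {..<n} \<and> P G \<longrightarrow>
        (\<exists>t s. exec c (graph_store n G) t s \<and> t \<le> poly p n \<and> R G (output_list n s)))"

end

theory Submission
  imports Defs
begin

text \<open>
  The end \<open>v\<close> of a longest path in a connected graph is not a cut vertex, all its neighbours lying on
  the path. In a \<open>K\<^sub>4\<close>-minor-free graph some such \<open>v\<close> has degree at most 2. Otherwise take, among all
  longest paths, one whose end \<open>v\<close> has a neighbour \<open>b\<close>, other than its predecessor, as late as
  possible on the path. Then \<open>v\<close> has a third neighbour before \<open>b\<close>. The path that goes to \<open>b\<close>, jumps to
  \<open>v\<close> and runs back to the successor \<open>y\<close> of \<open>b\<close> is also longest, so \<open>y\<close> has a neighbour before \<open>b\<close>
  too. Now \<open>{v}\<close>, \<open>{b}\<close>, the segment before \<open>b\<close> and the segment from \<open>y\<close> to the predecessor of \<open>v\<close>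
  contract to \<open>K\<^sub>4\<close>.

  Removing non-cut vertices of degree at most 2 one by one and reversing gives a connected ordering
  in which every vertex has at most 2 earlier neighbours, so the greedy colouring uses at most 3
  colours. On a bipartite graph every connected ordering makes it use the bipartition. Any
  removable vertex will do at each step, since what remains is again connected, so no longest path has
  to be found.
\<close>

section \<open>Connected sets and minors\<close>

text \<open>For symmetric \<open>E\<close> this is connectedness of the subgraph induced by
  \<open>A\<close>, with the empty set counted as connected. Speaking of cuts instead of walks makes
  it easy to pass to enlarged sets and to contractions.\<close>

definition cut_connected :: "'a rel \<Rightarrow> 'a set \<Rightarrow> bool" where
  "cut_connected E A \<longleftrightarrow> (\<forall>S. S \<subseteq> A \<and> S \<noteq> {} \<and> S \<noteq> A \<longrightarrow> (\<exists>x\<in>S. \<exists>y\<in>A - S. (x, y) \<in> E))"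

lemma cut_connectedE:
  assumes "cut_connected E A" "S \<subseteq> A" "S \<noteq> {}" "S \<noteq> A"
  obtains x y where "x \<in> S" "y \<in> A - S" "(x, y) \<in> E"
  using assms unfolding cut_connected_def by meson

lemma cut_connected_empty [simp]: "cut_connected E {}"
  by (simp add: cut_connected_def)

lemma cut_connected_singleton [simp]: "cut_connected E {x}"
  by (auto simp: cut_connected_def)

text \<open>A cut that splits \<open>A\<close> is crossed inside \<open>A\<close>; any other cut
  separates \<open>v\<close> from all of \<open>A\<close>, hence from \<open>x\<close>, and
  \<open>sym E\<close> supplies the edge in the direction required.\<close>

lemma cut_connected_insert:
  assumes "sym E" "cut_connected E A" "x \<in> A" "(x, v) \<in> E"
  shows "cut_connected E (insert v A)"
  unfolding cut_connected_def
proof (intro allI impI)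
  fix S assume S: "S \<subseteq> insert v A \<and> S \<noteq> {} \<and> S \<noteq> insert v A"
  have vx: "(v, x) \<in> E" using assms by (meson symD)
  show "\<exists>x\<in>S. \<exists>y\<in>insert v A - S. (x, y) \<in> E"
  proof (cases "S \<inter> A = {} \<or> S \<inter> A = A")
    case True
    then show ?thesis using S vx assms(3,4) by blast
  next
    case False
    then obtain a b where "a \<in> S \<inter> A" "b \<in> A - S \<inter> A" "(a, b) \<in> E"
      using cut_connectedE[OF assms(2), of "S \<inter> A"] by blast
    then show ?thesis by blast
  qed
qed

lemma cut_connected_path:
  assumes "sym E" "successively (\<lambda>x y. (x, y) \<in> E) xs"
  shows "cut_connected E (set xs)"
  using assms(2)
proof (induction xs)
  case (Cons x xs)
  show ?case
  proof (cases xs)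
    case (Cons y ys)
    then have "(y, x) \<in> E" "cut_connected E (set xs)"
      using Cons.prems Cons.IH \<open>sym E\<close> by (auto dest: symD)
    then show ?thesis
      using cut_connected_insert[OF \<open>sym E\<close>, of "set xs" y x] Cons by simp
  qed simp
qed simp

text \<open>Links the library's reachability to cuts: no edge leaves the set reachable from
  \<open>u\<close>, so that set is everything; conversely a walk cannot leave a set that no edge
  leaves.\<close>

lemma connected_induced_iff:
  assumes "sym (parcs G)"
  shows "Digraph_Component.connected (with_proj G \<restriction> S) \<longleftrightarrow> S \<noteq> {} \<and> cut_connected (parcs G) S"
proof -
  define F where "F = {(x, y) \<in> parcs G. x \<in> S \<and> y \<in> S}"
  \<comment> \<open>The arcs being symmetric already, symmetrising adds nothing.\<close>
  have "mk_symmetric (with_proj G \<restriction> S) = \<lparr> pverts = S, parcs = F \<rparr>"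
    using assms unfolding mk_symmetric_def F_def by (auto dest: symD)
  then have eq: "Digraph_Component.connected (with_proj G \<restriction> S) \<longleftrightarrow>
      S \<noteq> {} \<and> (\<forall>u\<in>S. \<forall>v\<in>S. (u, v) \<in> rtrancl_on S F)"
    unfolding Digraph_Component.connected_def strongly_connected_def reachable_def by simp
  have "cut_connected (parcs G) S \<longleftrightarrow> (\<forall>u\<in>S. \<forall>v\<in>S. (u, v) \<in> rtrancl_on S F)"
  proof
    assume c: "cut_connected (parcs G) S"
    show "\<forall>u\<in>S. \<forall>v\<in>S. (u, v) \<in> rtrancl_on S F"
    proof (intro ballI)
      fix u v assume uv: "u \<in> S" "v \<in> S"
      define T where "T = {w \<in> S. (u, w) \<in> rtrancl_on S F}"
      have "T = S"
      proof (rule ccontr)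
        assume "T \<noteq> S"
        moreover have "u \<in> T" "T \<subseteq> S" using uv by (auto simp: T_def)
        ultimately obtain x y where xy: "x \<in> T" "y \<in> S - T" "(x, y) \<in> parcs G"
          using cut_connectedE[OF c, of T] by blast
        then have "(x, y) \<in> F" by (auto simp: F_def T_def)
        then have "y \<in> T" using xy
          by (auto simp: T_def intro: rtrancl_on_into_rtrancl_on)
        then show False using xy by simp
      qed
      then show "(u, v) \<in> rtrancl_on S F" using uv by (auto simp: T_def)
    qed
  next
    assume r: "\<forall>u\<in>S. \<forall>v\<in>S. (u, v) \<in> rtrancl_on S F"
    show "cut_connected (parcs G) S"
      unfolding cut_connected_def
    proof (intro allI impI)
      fix T assume T: "T \<subseteq> S \<and> T \<noteq> {} \<and> T \<noteq> S"
      then obtain u v where uv: "u \<in> T" "v \<in> S" "v \<notin> T" by blast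
      show "\<exists>x\<in>T. \<exists>y\<in>S - T. (x, y) \<in> parcs G"
      proof (rule ccontr)
        assume neg: "\<not> ?thesis"
        have "(u, v) \<in> rtrancl_on S F" using r uv T by blast
        then have "v \<in> T"
          by (induction rule: rtrancl_on_induct) (use uv neg in \<open>auto simp: F_def\<close>)
        then show False using uv by simp
      qed
    qed
  qed
  then show ?thesis using eq by simp
qed

lemma connected_graph_iff:
  assumes "pair_graph G"
  shows "connected_graph G \<longleftrightarrow> pverts G \<noteq> {} \<and> cut_connected (parcs G) (pverts G)"
proof -
  interpret pair_graph G by fact
  have "with_proj G \<restriction> pverts G = with_proj G"
    by (auto simp: induce_subgraph_def with_proj_def dest: wellformed')
  then show ?thesis
    using connected_induced_iff[of G "pverts G"] sym_arcs by (simp add: symmetric_def)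
qed

section \<open>Vertex deletion and edge contraction\<close>

lemma pair_graphI:
  assumes "finite (pverts G)" "parcs G \<subseteq> pverts G \<times> pverts G" "sym (parcs G)" "irrefl (parcs G)"
  shows "pair_graph G"
proof -
  have "finite (parcs G)" using assms(1,2) by (meson finite_SigmaI finite_subset)
  then show ?thesis
    using assms by unfold_locales (auto simp: symmetric_def irrefl_def)
qed

lemma pair_graphD:
  assumes "pair_graph G"
  shows "finite (pverts G)" "parcs G \<subseteq> pverts G \<times> pverts G" "sym (parcs G)" "irrefl (parcs G)"
proof -
  interpret pair_graph G by fact
  show "finite (pverts G)" "parcs G \<subseteq> pverts G \<times> pverts G" "sym (parcs G)" "irrefl (parcs G)"
    using sym_arcs no_loops[of "(x, x)" for x]
    by (auto simp: symmetric_def irrefl_def dest: wellformed')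
qed

lemma pair_graph_delete_vertex:
  assumes "pair_graph G"
  shows "pair_graph (delete_vertex G v)"
  using pair_graphD[OF assms]
  by (intro pair_graphI) (auto simp: delete_vertex_def sym_def irrefl_def)

lemma pair_graph_contract_edge:
  assumes "pair_graph G" "(u, v) \<in> parcs G"
  shows "pair_graph (contract_edge G u v)"
proof (rule pair_graphI)
  have "u \<noteq> v" "u \<in> pverts G" using pair_graphD[OF assms(1)] assms(2) by (auto simp: irrefl_def)
  then show "parcs (contract_edge G u v) \<subseteq> pverts (contract_edge G u v) \<times> pverts (contract_edge G u v)"
    using pair_graphD(2)[OF assms(1)] by (auto simp: contract_edge_def)
  show "sym (parcs (contract_edge G u v))"
    using pair_graphD(3)[OF assms(1)] unfolding contract_edge_def sym_def by (simp add: Let_def) metis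
qed (use pair_graphD[OF assms(1)] in \<open>auto simp: contract_edge_def irrefl_def Let_def\<close>)

lemma contract_edge_arcI:
  assumes "f = (\<lambda>w. if w = v then u else w)" "(x, y) \<in> parcs G" "f x \<noteq> f y"
  shows "(f x, f y) \<in> parcs (contract_edge G u v)"
proof -
  have "(f x, f y) \<in> {(f x, f y) | x y. (x, y) \<in> parcs G \<and> f x \<noteq> f y}"
    using assms(2,3) by blast
  then show ?thesis unfolding contract_edge_def Let_def assms(1) by (simp only: pair_pre_digraph.select_convs)
qed

text \<open>A cut \<open>S\<close> after the contraction is pulled back to its preimage
  \<open>T\<close> in \<open>B\<close>; an edge crossing \<open>T\<close> is mapped to one crossing
  \<open>S\<close>. The condition on \<open>u\<close> and \<open>v\<close> makes the contraction map
  \<open>B\<close> into \<open>B - {v}\<close>.\<close>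

lemma cut_connected_contract_edge:
  assumes c: "cut_connected (parcs G) B" and uB: "u \<in> B \<or> v \<notin> B" "u \<noteq> v"
  shows "cut_connected (parcs (contract_edge G u v)) (B - {v})"
  unfolding cut_connected_def
proof (intro allI impI)
  fix S assume S: "S \<subseteq> B - {v} \<and> S \<noteq> {} \<and> S \<noteq> B - {v}"
  define T where "T = S \<union> (if u \<in> S \<and> v \<in> B then {v} else {})"
  have "T \<subseteq> B" "T \<noteq> {}" "T \<noteq> B" using S uB by (auto simp: T_def split: if_splits)
  then obtain x y where xy: "x \<in> T" "y \<in> B - T" "(x, y) \<in> parcs G"
    by (rule cut_connectedE[OF c])
  define f where "f = (\<lambda>w. if w = v then u else w)"
  have fx: "f x \<in> S" using xy(1) S by (auto simp: f_def T_def split: if_splits)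
  have fy: "f y \<in> B - {v} - S" using xy(2) S uB fx by (auto simp: f_def T_def split: if_splits)
  have "f x \<noteq> f y" using fx fy by (metis DiffD2)
  then have "(f x, f y) \<in> parcs (contract_edge G u v)"
    by (rule contract_edge_arcI[OF f_def xy(3)])
  then show "\<exists>x\<in>S. \<exists>y\<in>B - {v} - S. (x, y) \<in> parcs (contract_edge G u v)"
    using fx fy by blast
qed

text \<open>Induction on the number of vertices: a vertex outside all branch sets is deleted, an
  edge inside a branch set with two vertices is contracted. If neither exists, the branch sets are
  singletons exhausting the graph, which is therefore complete.\<close>

lemma complete_minor_of_branch_sets:
  assumes "pair_graph G"
    and "\<And>i. i < k \<Longrightarrow> B i \<noteq> {} \<and> B i \<subseteq> pverts G \<and> cut_connected (parcs G) (B i)"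
    and "\<And>i j. i < k \<Longrightarrow> j < k \<Longrightarrow> i \<noteq> j \<Longrightarrow> B i \<inter> B j = {} \<and> (\<exists>x\<in>B i. \<exists>y\<in>B j. (x, y) \<in> parcs G)"
  shows "\<exists>H. minor_step\<^sup>*\<^sup>* G H \<and> complete_digraph k (with_proj H)"
  using assms
proof (induction "card (pverts G)" arbitrary: G B rule: less_induct)
  case less
  note pg = less.prems(1) and B = less.prems(2) and BB = less.prems(3)
  note G = pair_graphD[OF pg]
  have smaller: "\<exists>H. minor_step\<^sup>*\<^sup>* G H \<and> complete_digraph k (with_proj H)"
    if "minor_step G G'" "card (pverts G') < card (pverts G)" "pair_graph G'"
      "\<And>i. i < k \<Longrightarrow> C i \<noteq> {} \<and> C i \<subseteq> pverts G' \<and> cut_connected (parcs G') (C i)"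
      "\<And>i j. i < k \<Longrightarrow> j < k \<Longrightarrow> i \<noteq> j \<Longrightarrow> C i \<inter> C j = {} \<and> (\<exists>x\<in>C i. \<exists>y\<in>C j. (x, y) \<in> parcs G')"
    for G' C
  proof -
    have "\<exists>H. minor_step\<^sup>*\<^sup>* G' H \<and> complete_digraph k (with_proj H)"
      by (rule less.hyps[of G' C]; fact that)
    then show ?thesis using that(1) by (meson converse_rtranclp_into_rtranclp)
  qed
  consider (unused) v where "v \<in> pverts G" "v \<notin> (\<Union>i<k. B i)"
    | (big) i x y where "i < k" "x \<in> B i" "y \<in> B i" "x \<noteq> y"
    | (single) "pverts G = (\<Union>i<k. B i)" "\<And>i. i < k \<Longrightarrow> \<exists>x. B i = {x}"
  proof (cases "pverts G = (\<Union>i<k. B i) \<and> (\<forall>i<k. \<exists>x. B i = {x})")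
    case False
    show ?thesis
    proof (cases "pverts G = (\<Union>i<k. B i)")
      case True
      then obtain i where i: "i < k" "\<nexists>x. B i = {x}" using False by blast
      then obtain x where x: "x \<in> B i" using B by blast
      then obtain y where "y \<in> B i" "x \<noteq> y" using i(2) by blast
      then show ?thesis using that(2) i x by blast
    next
      case False
      moreover have "(\<Union>i<k. B i) \<subseteq> pverts G" using B by blast
      ultimately show ?thesis using that(1) by blast
    qed
  qed (use that(3) in blast)
  then show ?case
  proof cases
    case unused
    have in_arcs: "(x, y) \<in> parcs (delete_vertex G v)" if "(x, y) \<in> parcs G" "i < k" "x \<in> B i" "j < k" "y \<in> B j" for x y i j
      using that unused by (auto simp: delete_vertex_def)
    show ?thesis
    proof (rule smaller[of "delete_vertex G v" B])
      show "minor_step G (delete_vertex G v)" using unused by (simp add: minor_step.intros)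
      show "card (pverts (delete_vertex G v)) < card (pverts G)"
        using unused(1) G(1) by (simp add: delete_vertex_def card_Diff1_less del: card_Diff_insert)
      show "pair_graph (delete_vertex G v)" using pg by (rule pair_graph_delete_vertex)
      fix i assume i: "i < k"
      have "cut_connected (parcs (delete_vertex G v)) (B i)"
        unfolding cut_connected_def
      proof (intro allI impI)
        fix S assume S: "S \<subseteq> B i \<and> S \<noteq> {} \<and> S \<noteq> B i"
        then obtain x y where "x \<in> S" "y \<in> B i - S" "(x, y) \<in> parcs G"
          using cut_connectedE[of "parcs G" "B i" S] B[OF i] by blast
        then show "\<exists>x\<in>S. \<exists>y\<in>B i - S. (x, y) \<in> parcs (delete_vertex G v)"
          using in_arcs i S by blast
      qed
      then show "B i \<noteq> {} \<and> B i \<subseteq> pverts (delete_vertex G v) \<and> cut_connected (parcs (delete_vertex G v)) (B i)"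
        using B[OF i] unused i by (auto simp: delete_vertex_def)
    next
      fix i j assume "i < k" "j < k" "i \<noteq> j"
      then show "B i \<inter> B j = {} \<and> (\<exists>x\<in>B i. \<exists>y\<in>B j. (x, y) \<in> parcs (delete_vertex G v))"
        using BB[of i j] in_arcs by blast
    qed
  next
    case big
    then have "cut_connected (parcs G) (B i)" "{x} \<subseteq> B i" "{x} \<noteq> {}" "{x} \<noteq> B i"
      using B[of i] by auto
    \<comment> \<open>Splitting \<open>x\<close> off the connected set \<open>B i\<close> yields an
      edge inside it to contract.\<close>
    then obtain u v where "u \<in> {x}" "v \<in> B i - {x}" and uv: "(u, v) \<in> parcs G"
      by (rule cut_connectedE)
    then have uvB: "u \<in> B i" "v \<in> B i" "u \<noteq> v" using big by auto
    have other: "v \<notin> B j" "u \<notin> B j" if "j < k" "j \<noteq> i" for j using BB[of i j] big uvB that by blast+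
    define f where "f = (\<lambda>w. if w = v then u else w)"
    \<comment> \<open>Only \<open>B i\<close> contains \<open>v\<close>, and it also contains
      \<open>u\<close>, so the contraction maps every branch set into itself without
      \<open>v\<close>.\<close>
    have fB: "f w \<in> B j - {v}" if "j < k" "w \<in> B j" for j w
      using that other[of j] uvB by (auto simp: f_def)
    show ?thesis
    proof (rule smaller[of "contract_edge G u v" "\<lambda>j. B j - {v}"])
      show "minor_step G (contract_edge G u v)" using uv by (simp add: minor_step.intros)
      have "v \<in> pverts G" using uvB B[OF big(1)] by blast
      then show "card (pverts (contract_edge G u v)) < card (pverts G)"
        using G(1) by (simp add: contract_edge_def Let_def card_Diff1_less del: card_Diff_insert)
      show "pair_graph (contract_edge G u v)" using pg uv by (rule pair_graph_contract_edge)
      fix j assume j: "j < k"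
      have "cut_connected (parcs (contract_edge G u v)) (B j - {v})"
        using B[OF j] other[OF j] uvB by (intro cut_connected_contract_edge) blast+
      moreover have "B j - {v} \<noteq> {}" using fB[OF j] B[OF j] by blast
      ultimately show "B j - {v} \<noteq> {} \<and> B j - {v} \<subseteq> pverts (contract_edge G u v) \<and>
          cut_connected (parcs (contract_edge G u v)) (B j - {v})"
        using B[OF j] by (auto simp: contract_edge_def Let_def)
    next
      fix j l assume jl: "j < k" "l < k" "j \<noteq> l"
      then obtain x y where xy: "x \<in> B j" "y \<in> B l" "(x, y) \<in> parcs G" and disj: "B j \<inter> B l = {}"
        using BB[of j l] by blast
      have "f x \<noteq> f y" using fB[OF jl(1) xy(1)] fB[OF jl(2) xy(2)] disj by auto
      then have "(f x, f y) \<in> parcs (contract_edge G u v)"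
        by (rule contract_edge_arcI[OF f_def xy(3)])
      then have "\<exists>x\<in>B j - {v}. \<exists>y\<in>B l - {v}. (x, y) \<in> parcs (contract_edge G u v)"
        using fB[OF jl(1) xy(1)] fB[OF jl(2) xy(2)] by blast
      then show "(B j - {v}) \<inter> (B l - {v}) = {} \<and>
          (\<exists>x\<in>B j - {v}. \<exists>y\<in>B l - {v}. (x, y) \<in> parcs (contract_edge G u v))"
        using disj by blast
    qed
  next
    case single
    then obtain b where b: "\<And>i. i < k \<Longrightarrow> B i = {b i}" by metis
    have V: "pverts G = b ` {..<k}" using single(1) b by auto
    have "inj_on b {..<k}"
    proof (rule inj_onI)
      fix i j assume "i \<in> {..<k}" "j \<in> {..<k}" "b i = b j"
      then show "i = j" using BB[of i j] b[of i] b[of j] by auto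
    qed
    then have "card (pverts G) = k" using V by (simp add: card_image)
    moreover have "parcs G = {(u, v). (u, v) \<in> pverts G \<times> pverts G \<and> u \<noteq> v}"
    proof (intro equalityI subsetI)
      fix e assume "e \<in> {(u, v). (u, v) \<in> pverts G \<times> pverts G \<and> u \<noteq> v}"
      then obtain i j where ij: "i < k" "j < k" "e = (b i, b j)" "b i \<noteq> b j" using V by auto
      then have "i \<noteq> j" by auto
      then show "e \<in> parcs G" using BB[of i j] b[of i] b[of j] ij by auto
    qed (use G in \<open>auto simp: irrefl_def\<close>)
    ultimately have "complete_digraph k (with_proj G)"
      using G(1) by (simp add: complete_digraph_pair_def)
    then show ?thesis by blast
  qed
qed

section \<open>Ends of longest paths\<close>

definition path_in :: "'a rel \<Rightarrow> 'a set \<Rightarrow> 'a list \<Rightarrow> bool" where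
  "path_in E A p \<longleftrightarrow> distinct p \<and> set p \<subseteq> A \<and> successively (\<lambda>x y. (x, y) \<in> E) p"

lemma longest_path:
  assumes "finite A" "A \<noteq> {}"
  obtains p where "path_in E A p" "p \<noteq> []" "\<And>q. path_in E A q \<Longrightarrow> length q \<le> length p"
proof -
  obtain a where "a \<in> A" using assms by blast
  then have a: "path_in E A [a]" by (simp add: path_in_def)
  have "length q < Suc (card A)" if "path_in E A q" for q
    using that assms(1) by (metis card_mono distinct_card less_Suc_eq_le path_in_def)
  then obtain p where p: "path_in E A p" "\<And>q. path_in E A q \<Longrightarrow> length q \<le> length p"
    using ex_has_greatest_nat[of "path_in E A" "[a]" length "Suc (card A)"] a by (meson less_imp_le)
  then have "p \<noteq> []" using a by fastforce
  then show thesis using p that by blast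
qed

text \<open>A neighbour off the path could be appended to make it longer.\<close>

lemma longest_path_end_neighbours:
  assumes "sym E" "path_in E A (xs @ [v])" "\<And>q. path_in E A q \<Longrightarrow> length q \<le> length (xs @ [v])"
    and "(v, w) \<in> E" "w \<in> A"
  shows "w \<in> set (xs @ [v])"
proof (rule ccontr)
  assume "w \<notin> set (xs @ [v])"
  then have "path_in E A (xs @ [v, w])"
    using assms(2,4,5) by (auto simp: path_in_def successively_append_iff)
  then show False using assms(3) by fastforce
qed

text \<open>All neighbours of \<open>v\<close> in \<open>A\<close> lie in \<open>xs\<close>, which
  is connected, being a path. A cut of \<open>A - {v}\<close> that splits \<open>xs\<close> is
  crossed by a path edge; any other cut extends to one of \<open>A\<close>.\<close>

lemma longest_path_end_not_cut:
  assumes "sym E" "path_in E A (xs @ [v])" "\<And>q. path_in E A q \<Longrightarrow> length q \<le> length (xs @ [v])"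
    and c: "cut_connected E A"
  shows "cut_connected E (A - {v})"
  unfolding cut_connected_def
proof (intro allI impI)
  fix S assume S: "S \<subseteq> A - {v} \<and> S \<noteq> {} \<and> S \<noteq> A - {v}"
  have vA: "v \<in> A" "set xs \<subseteq> A - {v}" using assms(2) by (auto simp: path_in_def)
  have nb: "w \<in> set xs" if "(v, w) \<in> E" "w \<in> A" "w \<noteq> v" for w
    using longest_path_end_neighbours[OF assms(1-3) that(1,2)] that(3) by simp
  have p: "cut_connected E (set xs)"
    using assms(1,2) by (intro cut_connected_path) (auto simp: path_in_def successively_append_iff)
  show "\<exists>x\<in>S. \<exists>y\<in>A - {v} - S. (x, y) \<in> E"
  proof (cases "S \<inter> set xs = {} \<or> S \<inter> set xs = set xs")
    case True
    \<comment> \<open>\<open>v\<close> is put on the side that contains \<open>xs\<close>, so an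
      edge crossing this cut of \<open>A\<close> is not incident with \<open>v\<close>.\<close>
    let ?T = "if S \<inter> set xs = {} then S else insert v S"
    have "?T \<subseteq> A" "?T \<noteq> {}" "?T \<noteq> A" using S vA by (auto split: if_splits)
    then obtain x y where xy: "x \<in> ?T" "y \<in> A - ?T" "(x, y) \<in> E" by (rule cut_connectedE[OF c])
    moreover have "(y, x) \<in> E" using xy(3) \<open>sym E\<close> by (meson symD)
    ultimately have "x \<noteq> v \<and> y \<noteq> v \<and> x \<in> S \<and> y \<notin> S"
      using nb[of x] nb[of y] S True vA by (auto split: if_splits)
    then show ?thesis using xy S by (auto split: if_splits)
  next
    case False
    then obtain x y where "x \<in> S \<inter> set xs" "y \<in> set xs - S \<inter> set xs" "(x, y) \<in> E"
      using cut_connectedE[OF p, of "S \<inter> set xs"] by blast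
    then show ?thesis using vA by blast
  qed
qed

text \<open>\<open>a\<close> and \<open>b\<close> may coincide, which covers the case of a single
  exceptional neighbour.\<close>

lemma third_element:
  assumes "2 < card N" "N \<subseteq> X \<union> {a, b}"
  shows "\<exists>x\<in>N. x \<in> X"
proof (rule ccontr)
  assume "\<not> ?thesis"
  then have "N \<subseteq> {a, b}" using assms by blast
  then have "card N \<le> card {a, b}" by (intro card_mono) auto
  then show False using assms(1) by (auto simp: card_insert_if split: if_splits)
qed

text \<open>Paths and degrees are taken within \<open>A\<close>, while the minor is found in
  \<open>G\<close>: in the application \<open>A\<close> consists of the vertices not yet
  removed.\<close>

lemma K4_of_longest_path_ends:
  assumes G: "pair_graph G" and A: "A \<subseteq> pverts G" "A \<noteq> {}"
    and deg: "\<And>xs v. path_in (parcs G) A (xs @ [v]) \<Longrightarrow>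
      (\<And>q. path_in (parcs G) A q \<Longrightarrow> length q \<le> length (xs @ [v])) \<Longrightarrow>
      2 < card {w \<in> A. (v, w) \<in> parcs G}"
  shows "\<not> K4_minor_free G"
proof -
  let ?E = "parcs G"
  note Gs = pair_graphD[OF G]
  have symE: "(y, x) \<in> ?E" if "(x, y) \<in> ?E" for x y using Gs(3) that by (meson symD)
  have irr: "(x, x) \<notin> ?E" for x using Gs(4) by (auto simp: irrefl_def)
  obtain p where p: "path_in ?E A p" "p \<noteq> []" "\<And>q. path_in ?E A q \<Longrightarrow> length q \<le> length p"
    using longest_path[OF finite_subset[OF A(1) Gs(1)] A(2), of ?E] by blast
  define L where "L q \<longleftrightarrow> path_in ?E A q \<and> length q = length p" for q
  have Ldeg: "2 < card {w \<in> A. (v, w) \<in> ?E}" if "L (xs @ [v])" for xs v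
    using that p(3) by (intro deg) (auto simp: L_def)
  have Lnb: "w \<in> set xs" if "L (xs @ [v])" "(v, w) \<in> ?E" "w \<in> A" for xs v w
    using longest_path_end_neighbours[OF Gs(3), of A xs v w] p(3) that irr by (auto simp: L_def)
  \<comment> \<open>\<open>b\<close> is the neighbour of the end \<open>v\<close> closest to it along the path, its predecessor excepted.\<close>
  define D where "D k \<longleftrightarrow> (\<exists>xs b zs v. length xs = k \<and> L (xs @ b # zs @ [v]) \<and> zs \<noteq> [] \<and> (v, b) \<in> ?E)" for k
  have "\<exists>k. D k"
  proof -
    obtain xs v where pv: "p = xs @ [v]" using p(2) by (meson rev_exhaust)
    have Lp: "L (xs @ [v])" using p(1) pv by (simp add: L_def)
    \<comment> \<open>\<open>last xs\<close> is the predecessor of \<open>v\<close>; having more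
      than two neighbours, \<open>v\<close> has another one, which makes some \<open>D k\<close>
      true.\<close>
    have "{w \<in> A. (v, w) \<in> ?E} \<subseteq> set (butlast xs) \<union> {last xs, last xs}"
    proof
      fix w assume "w \<in> {w \<in> A. (v, w) \<in> ?E}"
      then have "w \<in> set xs" using Lnb[OF Lp] by blast
      then show "w \<in> set (butlast xs) \<union> {last xs, last xs}"
        by (cases xs rule: rev_cases) auto
    qed
    then obtain b where b: "(v, b) \<in> ?E" "b \<in> set (butlast xs)"
      using third_element[OF Ldeg[OF Lp]] by blast
    then obtain us vs where "butlast xs = us @ b # vs" by (meson split_list)
    then have "xs = us @ b # vs @ [last xs]"
      by (metis append_Cons append_assoc append_butlast_last_id butlast.simps(1) append_is_Nil_conv list.distinct(1))
    then have "xs @ [v] = us @ b # (vs @ [last xs]) @ [v]"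
      by (metis append_Cons append_assoc)
    then have "L (us @ b # (vs @ [last xs]) @ [v])" using Lp by metis
    then show ?thesis unfolding D_def using b(1) by blast
  qed
  moreover have "k \<le> length p" if "D k" for k using that by (auto simp: D_def L_def)
  ultimately obtain k where k: "D k" "\<And>j. D j \<Longrightarrow> j \<le> k"
    by (metis (mono_tags) Greatest_le_nat GreatestI_ex_nat)
  \<comment> \<open>A neighbour of \<open>v\<close> strictly between \<open>b\<close> and
    \<open>last zs\<close> would contradict the maximality of \<open>k\<close>, so the third
    neighbour guaranteed by the degree lies before \<open>b\<close>.\<close>
  have key: "\<exists>a\<in>set xs. (v, a) \<in> ?E"
    if Lv: "L (xs @ b # zs @ [v])" and "length xs = k" "zs \<noteq> []" for xs b zs v
  proof -
    have "{w \<in> A. (v, w) \<in> ?E} \<subseteq> set xs \<union> {b, last zs}"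
    proof
      fix w assume "w \<in> {w \<in> A. (v, w) \<in> ?E}"
      then have w: "(v, w) \<in> ?E" "w \<in> set (xs @ b # zs)" using Lnb[of "xs @ b # zs" v w] Lv by auto
      show "w \<in> set xs \<union> {b, last zs}"
      proof (rule ccontr)
        assume n: "w \<notin> set xs \<union> {b, last zs}"
        then have "w \<in> set zs" using w by auto
        then obtain us vs where z: "zs = us @ w # vs" by (meson split_list)
        then have "vs \<noteq> []" using n by auto
        moreover have "L ((xs @ b # us) @ w # vs @ [v])" using Lv z by simp
        ultimately have "D (length (xs @ b # us))" unfolding D_def using w(1) by blast
        then show False using k(2) that(2) by fastforce
      qed
    qed
    moreover have "2 < card {w \<in> A. (v, w) \<in> ?E}" using Ldeg[of "xs @ b # zs" v] Lv by simp
    ultimately show ?thesis using third_element[of _ "set xs" b "last zs"] by blast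
  qed
  \<comment> \<open>Rotating the path along the chord \<open>vb\<close> gives a longest path ending in the successor \<open>y\<close> of \<open>b\<close>,
    to which \<open>key\<close> applies as well.\<close>
  obtain xs b zs v where P: "length xs = k" "L (xs @ b # zs @ [v])" "zs \<noteq> []" "(v, b) \<in> ?E"
    using k(1) unfolding D_def by blast
  obtain a where a: "a \<in> set xs" "(v, a) \<in> ?E" using key P by blast
  obtain y ys where zs: "zs = y # ys" using P(3) by (cases zs) auto
  have succ: "successively (\<lambda>x y. (x, y) \<in> ?E) (xs @ b # zs @ [v])"
    and dist: "distinct (xs @ b # zs @ [v])" and sub: "set (xs @ b # zs @ [v]) \<subseteq> A"
    using P(2) by (auto simp: L_def path_in_def)
  have "successively (\<lambda>x y. (x, y) \<in> ?E) zs"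
    using succ P(3) by (auto simp: successively_append_iff successively_Cons)
  then have rev_zs: "successively (\<lambda>x y. (y, x) \<in> ?E) zs"
    by (rule successively_mono) (use symE in blast)
  have "path_in ?E A (xs @ b # v # rev zs)"
    using succ dist sub symE P(3,4) rev_zs
    by (auto simp: path_in_def successively_append_iff successively_Cons hd_rev successively_rev)
  then have "L (xs @ b # (v # rev ys) @ [y])" using P(2) by (simp add: L_def zs)
  then obtain c where c: "c \<in> set xs" "(y, c) \<in> ?E" using key P(1) by blast
  \<comment> \<open>\<open>v\<close> meets the other sets through \<open>b\<close>,
    \<open>last zs\<close> and \<open>a\<close>; \<open>b\<close> meets the two segments through its
    path neighbours \<open>y\<close> and \<open>last xs\<close>; the segments meet through
    \<open>y\<close> and \<open>c\<close>.\<close>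
  define B where "B i = (if i = 0 then {v} else if i = 1 then {b} else if i = 2 then set zs else set xs)" for i :: nat
  have conn: "cut_connected ?E (set xs)" "cut_connected ?E (set zs)"
    using succ by (auto intro!: cut_connected_path[OF Gs(3)] simp: successively_append_iff successively_Cons)
  have "xs \<noteq> []" using a(1) by auto
  then have e1: "(last xs, b) \<in> ?E" "last xs \<in> set xs" "(b, y) \<in> ?E" "(last zs, v) \<in> ?E" "last zs \<in> set zs" "y \<in> set zs"
    using succ a(1) P(3) zs
    by (auto simp: successively_append_iff successively_Cons)
  have "\<exists>H. minor_step\<^sup>*\<^sup>* G H \<and> complete_digraph 4 (with_proj H)"
  proof (rule complete_minor_of_branch_sets[OF G, where B = B])
    fix i :: nat assume "i < 4"
    then show "B i \<noteq> {} \<and> B i \<subseteq> pverts G \<and> cut_connected ?E (B i)"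
      using sub A(1) conn P(3) a(1) by (auto simp: B_def)
  next
    fix i j :: nat assume ij: "i < 4" "j < 4" "i \<noteq> j"
    have "B i \<inter> B j = {}" using ij dist by (auto simp: B_def)
    moreover have "\<exists>x\<in>B i. \<exists>y\<in>B j. (x, y) \<in> ?E"
      if "i < j" "j < 4" for i j
    proof -
      have "(i, j) \<in> {(0, 1), (0, 2), (0, 3), (1, 2), (1, 3), (2, 3)}"
        using that by auto
      then show ?thesis using e1 a c P(4) symE by (auto simp: B_def)
    qed
    then have "\<exists>x\<in>B i. \<exists>y\<in>B j. (x, y) \<in> ?E"
      using ij symE by (metis nat_neq_iff)
    ultimately show "B i \<inter> B j = {} \<and> (\<exists>x\<in>B i. \<exists>y\<in>B j. (x, y) \<in> ?E)" by simp
  qed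
  then show ?thesis by (simp add: K4_minor_free_def)
qed

text \<open>Some longest path in \<open>A\<close> ends in a vertex of degree at most 2, for
  otherwise there would be a \<open>K4\<close> minor. Counting neighbours in \<open>A - {v}\<close>
  matches the program, which tests \<open>v\<close> while it is flagged as removed.\<close>

lemma ex_removable_vertex:
  assumes G: "pair_graph G" "K4_minor_free G" and A: "A \<subseteq> pverts G" "A \<noteq> {}"
    and c: "cut_connected (parcs G) A"
  shows "\<exists>v\<in>A. cut_connected (parcs G) (A - {v}) \<and> card {w \<in> A - {v}. (v, w) \<in> parcs G} \<le> 2"
proof -
  obtain xs v where v: "path_in (parcs G) A (xs @ [v])"
      "\<And>q. path_in (parcs G) A q \<Longrightarrow> length q \<le> length (xs @ [v])"
      "card {w \<in> A. (v, w) \<in> parcs G} \<le> 2"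
    using K4_of_longest_path_ends[OF G(1) A] G(2) by (meson not_le)
  have "cut_connected (parcs G) (A - {v})"
    using longest_path_end_not_cut[OF _ v(1,2) c] pair_graphD(3)[OF G(1)] by blast
  moreover have "card {w \<in> A - {v}. (v, w) \<in> parcs G} \<le> card {w \<in> A. (v, w) \<in> parcs G}"
    using finite_subset[OF A(1) pair_graphD(1)[OF G(1)]] by (intro card_mono) auto
  ultimately show ?thesis using v by (auto simp: path_in_def)
qed

section \<open>Greedy colourings of removal orderings\<close>

text \<open>Read backwards, the list removes vertices one by one, so the vertex appended last is the
  one removed first.\<close>

inductive removal_ordering :: "'a sgraph \<Rightarrow> 'a list \<Rightarrow> bool" for G where
  Nil: "removal_ordering G []"
| snoc: "removal_ordering G xs \<Longrightarrow> v \<notin> set xs \<Longrightarrow> cut_connected (parcs G) (insert v (set xs)) \<Longrightarrow>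
    card {w \<in> set xs. (v, w) \<in> parcs G} \<le> 2 \<Longrightarrow> removal_ordering G (xs @ [v])"

lemma removal_ordering_distinct: "removal_ordering G xs \<Longrightarrow> distinct xs"
  by (induction rule: removal_ordering.induct) auto

lemma removal_ordering_take:
  "removal_ordering G xs \<Longrightarrow> cut_connected (parcs G) (set (take i xs))"
proof (induction arbitrary: i rule: removal_ordering.induct)
  case (snoc xs v)
  then show ?case by (cases "i \<le> length xs") auto
qed simp

text \<open>A removable vertex goes to the end, and the induction continues with the rest, which is
  still connected.\<close>

lemma ex_removal_ordering:
  assumes "pair_graph G" "K4_minor_free G" "A \<subseteq> pverts G" "cut_connected (parcs G) A"
  shows "\<exists>xs. removal_ordering G xs \<and> set xs = A"
  using assms(3,4)
proof (induction "card A" arbitrary: A)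
  case 0
  then have "A = {}" using finite_subset[OF _ pair_graphD(1)[OF assms(1)]] by simp
  then show ?case using removal_ordering.Nil by force
next
  case (Suc n)
  then have "A \<noteq> {}" by auto
  then obtain v where v: "v \<in> A" "cut_connected (parcs G) (A - {v})"
      "card {w \<in> A - {v}. (v, w) \<in> parcs G} \<le> 2"
    using ex_removable_vertex[OF assms(1,2)] Suc.prems by blast
  then obtain xs where xs: "removal_ordering G xs" "set xs = A - {v}"
    using Suc.hyps(1)[of "A - {v}"] Suc.hyps(2) Suc.prems by fastforce
  then have "removal_ordering G (xs @ [v])"
    using v Suc.prems by (intro removal_ordering.snoc) (auto simp: insert_absorb)
  moreover have "set (xs @ [v]) = A" using xs v by auto
  ultimately show ?case by blast
qed

section \<open>The greedy colouring vertex by vertex\<close>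

lemma greedy_colouring_Nil [simp]: "greedy_colouring G [] = Map.empty"
  by (simp add: greedy_colouring_def)

lemma greedy_colouring_snoc:
  "greedy_colouring G (xs @ [v]) = greedy_step G (greedy_colouring G xs) v"
  by (simp add: greedy_colouring_def)

lemma dom_greedy_colouring: "dom (greedy_colouring G xs) = set xs"
  by (induction xs rule: rev_induct) (simp_all add: greedy_colouring_snoc greedy_step_def del: fun_upd_apply)

text \<open>Pigeonhole: of the first \<open>d + 1\<close> colours, \<open>d\<close> being the number
  of coloured neighbours, one is free. Hence the least free colour exists and is at most
  \<open>d + 1\<close>.\<close>

lemma greedy_step_colour:
  assumes "finite (dom c)"
  obtains k where "greedy_step G c v = c(v \<mapsto> k)" "1 \<le> k" "\<And>u. (u, v) \<in> parcs G \<Longrightarrow> c u \<noteq> Some k"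
    "k \<le> Suc (card {u \<in> dom c. (u, v) \<in> parcs G})"
proof -
  let ?N = "{u \<in> dom c. (u, v) \<in> parcs G}" and ?P = "\<lambda>k. 1 \<le> k \<and> (\<forall>u. (u, v) \<in> parcs G \<longrightarrow> c u \<noteq> Some k)"
  have fin: "finite ?N" using assms by simp
  have "\<not> {1..Suc (card ?N)} \<subseteq> (\<lambda>u. the (c u)) ` ?N"
  proof
    assume "{1..Suc (card ?N)} \<subseteq> (\<lambda>u. the (c u)) ` ?N"
    from surj_card_le[OF fin this] show False by simp
  qed
  then obtain j where j: "j \<in> {1..Suc (card ?N)}" "j \<notin> (\<lambda>u. the (c u)) ` ?N" by blast
  then have "?P j" by (force simp: dom_def image_iff)
  then have "?P (LEAST k. ?P k)" "(LEAST k. ?P k) \<le> j"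
    by (rule LeastI[of ?P], rule Least_le[of ?P])
  then show thesis using that[of "LEAST k. ?P k"] j(1) by (auto simp: greedy_step_def)
qed

lemma greedy_colouring_snocE:
  obtains k where "greedy_colouring G (xs @ [v]) = (greedy_colouring G xs)(v \<mapsto> k)" "1 \<le> k"
    "\<And>u. (u, v) \<in> parcs G \<Longrightarrow> greedy_colouring G xs u \<noteq> Some k"
    "k \<le> Suc (card {u \<in> set xs. (u, v) \<in> parcs G})"
proof -
  have "finite (dom (greedy_colouring G xs))" by (simp add: dom_greedy_colouring)
  then show thesis
    by (rule greedy_step_colour[of _ G v]) (rule that, simp_all add: greedy_colouring_snoc dom_greedy_colouring)
qed

lemma greedy_colouring_proper:
  assumes "pair_graph G" "distinct xs" "(u, w) \<in> parcs G" "u \<in> set xs" "w \<in> set xs"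
  shows "greedy_colouring G xs u \<noteq> greedy_colouring G xs w"
  using assms(2,4,5)
proof (induction xs rule: rev_induct)
  case (snoc v xs)
  obtain k where k: "greedy_colouring G (xs @ [v]) = (greedy_colouring G xs)(v \<mapsto> k)"
    "\<And>u. (u, v) \<in> parcs G \<Longrightarrow> greedy_colouring G xs u \<noteq> Some k"
    using greedy_colouring_snocE[of G xs v] by metis
  have "u \<noteq> w" "(w, u) \<in> parcs G"
    using pair_graphD(3,4)[OF assms(1)] assms(3) by (auto simp: irrefl_def dest: symD)
  then show ?case using snoc k(2)[of u] k(2)[of w] assms(3) by (auto simp: k(1))
qed simp

text \<open>Renaming the colours used to an initial segment gives a proper colouring that competes
  in the minimum. It also shows that the minimum is taken over a nonempty set and thus
  attained.\<close>

lemma chromatic_number_le_greedy_number: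
  assumes "pair_graph G" "ordering G xs"
  shows "chromatic_number G \<le> greedy_number G xs"
    and "\<exists>c. c ` pverts G \<subseteq> {1..chromatic_number G} \<and> (\<forall>(u, v) \<in> parcs G. c u \<noteq> c v)"
proof -
  let ?g = "greedy_colouring G xs"
  let ?P = "\<lambda>k. \<exists>c. c ` pverts G \<subseteq> {1..k} \<and> (\<forall>(u, v) \<in> parcs G. c u \<noteq> c v)"
  have dom: "dom ?g = pverts G" using assms(2) by (simp add: dom_greedy_colouring ordering_def)
  then have "finite (ran ?g)" using pair_graphD(1)[OF assms(1)] by (simp add: finite_ran)
  then obtain h where h: "bij_betw h (ran ?g) {1..card (ran ?g)}"
    using ex_bij_betw_nat_finite_1 bij_betw_inv by blast
  have "?P (greedy_number G xs)"
  proof (intro exI[of _ "\<lambda>v. h (the (?g v))"] conjI ballI)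
    have ran: "the (?g v) \<in> ran ?g" "?g v = Some (the (?g v))" if "v \<in> pverts G" for v
    proof -
      have "v \<in> dom ?g" using that dom by simp
      then show "the (?g v) \<in> ran ?g" "?g v = Some (the (?g v))" by (auto simp: ran_def)
    qed
    then show "(\<lambda>v. h (the (?g v))) ` pverts G \<subseteq> {1..greedy_number G xs}"
      using bij_betw_apply[OF h] by (force simp: greedy_number_def)
    fix e assume e: "e \<in> parcs G"
    obtain u v where uv: "e = (u, v)" by fastforce
    then have in_V: "u \<in> pverts G" "v \<in> pverts G" using e pair_graphD(2)[OF assms(1)] by auto
    then have "?g u \<noteq> ?g v"
      using greedy_colouring_proper[OF assms(1)] e uv assms(2) by (simp add: ordering_def)
    then have "the (?g u) \<noteq> the (?g v)" using ran(2)[OF in_V(1)] ran(2)[OF in_V(2)] by metis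
    then have "h (the (?g u)) \<noteq> h (the (?g v))"
      using h ran(1) in_V by (meson bij_betw_def inj_onD)
    then show "case e of (u, v) \<Rightarrow> h (the (?g u)) \<noteq> h (the (?g v))" by (simp add: uv)
  qed
  then show "chromatic_number G \<le> greedy_number G xs" "?P (chromatic_number G)"
    unfolding chromatic_number_def by (rule Least_le, rule LeastI)
qed

text \<open>With at most two earlier neighbours, one of the colours 1, 2, 3 is always free.\<close>

lemma removal_ordering_ran_greedy:
  assumes "pair_graph G" "removal_ordering G xs"
  shows "ran (greedy_colouring G xs) \<subseteq> {1..3}"
  using assms(2)
proof (induction rule: removal_ordering.induct)
  case (snoc xs v)
  obtain k where k: "greedy_colouring G (xs @ [v]) = (greedy_colouring G xs)(v \<mapsto> k)" "1 \<le> k"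
    "k \<le> Suc (card {u \<in> set xs. (u, v) \<in> parcs G})"
    using greedy_colouring_snocE[of G xs v] by metis
  have "{u \<in> set xs. (u, v) \<in> parcs G} = {w \<in> set xs. (v, w) \<in> parcs G}"
    using pair_graphD(3)[OF assms(1)] by (auto dest: symD)
  then have "k \<le> 3" using k(3) snoc by simp
  moreover have "ran ((greedy_colouring G xs)(v \<mapsto> k)) \<subseteq> insert k (ran (greedy_colouring G xs))"
    by (auto simp: ran_def)
  ultimately show ?case using k(2) snoc.IH unfolding k(1) by fastforce
qed simp

text \<open>The class of the first vertex gets colour 1. By connectedness every later vertex has an
  earlier neighbour; all its earlier neighbours lie in the other class and share one colour, which
  leaves the opposite colour as the least free one.\<close>

lemma removal_ordering_bipartite:
  assumes G: "pair_graph G" and r: "removal_ordering G xs"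
    and c: "\<And>v. c v \<in> {1, 2::nat}" "\<And>u v. (u, v) \<in> parcs G \<Longrightarrow> c u \<noteq> c v"
  shows "v \<in> set xs \<Longrightarrow> greedy_colouring G xs v = Some (if c v = c (hd xs) then 1 else 2)"
  using r
proof (induction arbitrary: v rule: removal_ordering.induct)
  case (snoc xs v x)
  note IH = snoc.IH and conn = snoc.hyps(3) and new = snoc.hyps(2)
  define k where "k = (LEAST k. 1 \<le> k \<and> (\<forall>u. (u, v) \<in> parcs G \<longrightarrow> greedy_colouring G xs u \<noteq> Some k))"
  have g: "greedy_colouring G (xs @ [v]) = (greedy_colouring G xs)(v \<mapsto> k)"
    by (simp add: greedy_colouring_snoc greedy_step_def k_def)
  have "k = (if c v = c (hd (xs @ [v])) then 1 else 2)"
  proof (cases "xs = []")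
    case True
    then show ?thesis by (auto simp: k_def intro: Least_equality)
  next
    case False
    let ?k = "if c v = c (hd xs) then 1 else 2 :: nat"
    have "set xs \<subseteq> insert v (set xs)" by blast
    moreover have "set xs \<noteq> {}" using False by simp
    moreover have "set xs \<noteq> insert v (set xs)" using new by blast
    \<comment> \<open>The earlier neighbour \<open>w\<close> of \<open>v\<close> is what rules out
      colour 1 when \<open>?k\<close> is 2.\<close>
    ultimately obtain w y where w: "w \<in> set xs" "y \<in> insert v (set xs) - set xs" "(w, y) \<in> parcs G"
      by (rule cut_connectedE[OF conn])
    then have wv: "(w, v) \<in> parcs G" by auto
    \<comment> \<open>\<open>3 - ?k\<close> is the other of the colours 1 and 2.\<close>
    have col: "greedy_colouring G xs u = Some (3 - ?k)" if "(u, v) \<in> parcs G" "u \<in> set xs" for u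
    proof -
      have "(c u = c (hd xs)) \<longleftrightarrow> (c v \<noteq> c (hd xs))"
        using c(2)[OF that(1)] c(1)[of u] c(1)[of v] c(1)[of "hd xs"] by (metis insertE singletonD)
      then show ?thesis using IH[OF that(2)] by simp
    qed
    have "k = ?k"
      unfolding k_def
    proof (rule Least_equality)
      show "1 \<le> ?k \<and> (\<forall>u. (u, v) \<in> parcs G \<longrightarrow> greedy_colouring G xs u \<noteq> Some ?k)"
      proof (intro conjI allI impI)
        fix u assume u: "(u, v) \<in> parcs G"
        show "greedy_colouring G xs u \<noteq> Some ?k"
        proof (cases "u \<in> set xs")
          case False
          then show ?thesis using dom_greedy_colouring[of G xs] by (auto simp: dom_def)
        qed (use col[OF u] in auto)
      qed auto
      fix j assume "1 \<le> j \<and> (\<forall>u. (u, v) \<in> parcs G \<longrightarrow> greedy_colouring G xs u \<noteq> Some j)"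
      then have "1 \<le> j" "j \<noteq> 3 - ?k" using col[OF wv w(1)] wv by auto
      then show "?k \<le> j" by auto
    qed
    then show ?thesis using False by simp
  qed
  moreover have "hd (xs @ [v]) = hd xs" if "x \<in> set xs" using that by (cases xs) auto
  ultimately show ?case using snoc.prems IH by (auto simp: g fun_upd_def split: if_splits)
qed simp

text \<open>Up to chromatic number 2 the greedy colouring reproduces an optimal one; beyond that the
  bound of three colours suffices.\<close>

lemma good_connected_ordering_of_removal_ordering:
  assumes G: "pair_graph G" and r: "removal_ordering G xs" "set xs = pverts G" "pverts G \<noteq> {}"
  shows "good_connected_ordering G xs"
proof -
  have ord: "ordering G xs" using r removal_ordering_distinct by (auto simp: ordering_def)
  have "connected_ordering G xs"
    unfolding connected_ordering_def
    using ord connected_induced_iff[OF pair_graphD(3)[OF G]] removal_ordering_take[OF r(1)] r(2,3) by auto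
  moreover have "greedy_number G xs \<le> chromatic_number G"
  proof (cases "chromatic_number G \<le> 2")
    case True
    obtain c where c: "c ` pverts G \<subseteq> {1..chromatic_number G}" "\<forall>(u, v) \<in> parcs G. c u \<noteq> c v"
      using chromatic_number_le_greedy_number(2)[OF G ord] by blast
    \<comment> \<open>The value 1 outside the graph makes \<open>d\<close> take values in
      \<open>{1, 2}\<close> everywhere.\<close>
    define d where "d v = (if v \<in> pverts G then c v else 1)" for v
    have d: "greedy_colouring G xs v = Some (if d v = d (hd xs) then 1 else 2)" if "v \<in> set xs" for v
    proof (rule removal_ordering_bipartite[OF G r(1) _ _ that])
      show "d v \<in> {1, 2}" for v
      proof (cases "v \<in> pverts G")
        case True
        then have "c v \<in> {1..2}" using c(1) \<open>chromatic_number G \<le> 2\<close> by fastforce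
        then show ?thesis using True by (auto simp: d_def)
      qed (simp add: d_def)
      show "d u \<noteq> d v" if "(u, v) \<in> parcs G" for u v
        using that c(2) pair_graphD(2)[OF G] by (auto simp: d_def)
    qed
    \<comment> \<open>Counting through the image of \<open>d\<close> also covers chromatic number 1,
      where a bound by 2 would be too weak.\<close>
    have "ran (greedy_colouring G xs) \<subseteq> (\<lambda>x. if x = d (hd xs) then 1 else 2) ` d ` pverts G"
    proof
      fix k assume "k \<in> ran (greedy_colouring G xs)"
      then obtain v where v: "greedy_colouring G xs v = Some k" by (auto simp: ran_def)
      then have "v \<in> pverts G" using dom_greedy_colouring[of G xs] r(2) by (auto simp: dom_def)
      then show "k \<in> (\<lambda>x. if x = d (hd xs) then 1 else 2) ` d ` pverts G" using v d[of v] r(2) by (auto split: if_splits)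
    qed
    moreover have "finite (d ` pverts G)" using pair_graphD(1)[OF G] by simp
    ultimately have "greedy_number G xs \<le> card (d ` pverts G)"
      unfolding greedy_number_def by (rule surj_card_le[rotated])
    also have "d ` pverts G \<subseteq> {1..chromatic_number G}" using c(1) by (auto simp: d_def)
    then have "card (d ` pverts G) \<le> chromatic_number G" by (metis card_atLeastAtMost card_mono diff_Suc_1 finite_atLeastAtMost)
    finally show ?thesis .
  next
    case False
    have "greedy_number G xs \<le> card {1..3::nat}"
      unfolding greedy_number_def using removal_ordering_ran_greedy[OF G r(1)] by (intro card_mono) auto
    then show ?thesis using False by simp
  qed
  ultimately show ?thesis
    using chromatic_number_le_greedy_number(1)[OF G ord] by (simp add: good_connected_ordering_def)
qed

section \<open>Good orderings exist, and graphs having one are not ugly\<close>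

lemma ex_good_connected_ordering:
  assumes "pair_graph G" "connected_graph G" "K4_minor_free G"
  shows "\<exists>\<sigma>. good_connected_ordering G \<sigma>"
  using ex_removal_ordering[OF assms(1,3) order.refl] assms(1,2) connected_graph_iff
    good_connected_ordering_of_removal_ordering by metis

lemma not_ugly_if_good_connected_ordering:
  assumes "good_connected_ordering G \<sigma>"
  shows "\<not> ugly G"
proof -
  have "connected_greedy_number G \<le> chromatic_number G"
    using assms unfolding connected_greedy_number_def good_connected_ordering_def by (intro Least_le) blast
  then show ?thesis by (simp add: ugly_def)
qed

section \<open>Loop programs\<close>

text \<open>
  \<open>For x p\<close> runs \<open>p\<close> for \<open>x = 0, \<dots>, n - 1\<close>, where \<open>n\<close> is the size of the input. Hence the
  meaning of a program is a function, and a polynomial bound on its running time can be read off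
  its syntax, so that correctness and running time can be treated separately.
\<close>

datatype prog = Nop | Put string aexp aexp | Then prog prog (infixr ";;" 60) | Branch bexp prog prog | For string prog

definition upd :: "store \<Rightarrow> string \<Rightarrow> nat \<Rightarrow> nat \<Rightarrow> store" where
  "upd s x i a = s(x := (s x)(i := a))"

lemma upd_apply [simp]: "upd s x i a y j = (if y = x \<and> j = i then a else s y j)"
  by (simp add: upd_def)

lemma upd_other: "y \<noteq> x \<Longrightarrow> upd s x i a y = s y"
  by (simp add: upd_def)

text \<open>After each round of \<open>For\<close> the counter is set from the index
  \<open>i\<close>, not incremented. This agrees with the increment in \<open>com_of\<close> if the
  body does not assign the counter, as \<open>loops_ok\<close> demands.\<close>

primrec run :: "nat \<Rightarrow> prog \<Rightarrow> store \<Rightarrow> store" where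
  "run n Nop = (\<lambda>s. s)"
| "run n (Put x i a) = (\<lambda>s. upd s x (aval i s) (aval a s))"
| "run n (p ;; q) = (\<lambda>s. run n q (run n p s))"
| "run n (Branch b p q) = (\<lambda>s. if bval b s then run n p s else run n q s)"
| "run n (For x p) = (\<lambda>s. foldl (\<lambda>s i. upd (run n p s) x 0 (Suc i)) (upd s x 0 0) [0..<n])"

primrec assigned :: "prog \<Rightarrow> string set" where
  "assigned Nop = {}"
| "assigned (Put x i a) = {x}"
| "assigned (p ;; q) = assigned p \<union> assigned q"
| "assigned (Branch b p q) = assigned p \<union> assigned q"
| "assigned (For x p) = insert x (assigned p)"

primrec loops_ok :: "prog \<Rightarrow> bool" where
  "loops_ok Nop \<longleftrightarrow> True"
| "loops_ok (Put x i a) \<longleftrightarrow> True"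
| "loops_ok (p ;; q) \<longleftrightarrow> loops_ok p \<and> loops_ok q"
| "loops_ok (Branch b p q) \<longleftrightarrow> loops_ok p \<and> loops_ok q"
| "loops_ok (For x p) \<longleftrightarrow> loops_ok p \<and> x \<notin> assigned p"

abbreviation Var :: "string \<Rightarrow> aexp" where
  "Var x \<equiv> Cell x (Const 0)"

primrec com_of :: "prog \<Rightarrow> com" where
  "com_of Nop = Skip"
| "com_of (Put x i a) = Assign x i a"
| "com_of (p ;; q) = Seq (com_of p) (com_of q)"
| "com_of (Branch b p q) = Cond b (com_of p) (com_of q)"
| "com_of (For x p) = Seq (Assign x (Const 0) (Const 0))
     (While (Less (Var x) (Var ''n'')) (Seq (com_of p) (Assign x (Const 0) (Plus (Var x) (Const 1)))))"

text \<open>\<open>[:0, 1:]\<close> evaluates to \<open>n\<close>. A loop pays for its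
  initialisation and the failing test once, and for a test and an increment in each round. Both
  branches of \<open>Branch\<close> are added up, as a polynomial stand-in for the maximum.\<close>

primrec cost :: "prog \<Rightarrow> nat poly" where
  "cost Nop = 1"
| "cost (Put x i a) = 1"
| "cost (p ;; q) = cost p + cost q"
| "cost (Branch b p q) = 1 + cost p + cost q"
| "cost (For x p) = 2 + [:0, 1:] * (cost p + 2)"

section \<open>Reasoning about loop programs and their running time\<close>

lemma run_frame: "y \<notin> assigned p \<Longrightarrow> run n p s y = s y"
proof (induction p arbitrary: s)
  case (For x p)
  have "foldl (\<lambda>s i. upd (run n p s) x 0 (Suc i)) s is y = s y" for s "is"
    by (induction "is" arbitrary: s) (use For in \<open>auto simp: upd_other\<close>)
  then show ?case using For.prems by (simp add: upd_other)
qed (auto simp: upd_other)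

text \<open>The invariant rule for loops: \<open>I i\<close> describes the store after
  \<open>i\<close> rounds, and the body may rely on the counter holding \<open>i\<close>.\<close>

lemma run_For:
  assumes "I 0 (upd s x 0 0)"
    and "\<And>i s. i < n \<Longrightarrow> I i s \<Longrightarrow> s x 0 = i \<Longrightarrow> I (Suc i) (upd (run n p s) x 0 (Suc i))"
  shows "I n (run n (For x p) s)"
proof -
  let ?F = "\<lambda>s i. upd (run n p s) x 0 (Suc i)"
  have "I m (foldl ?F (upd s x 0 0) [0..<m]) \<and> foldl ?F (upd s x 0 0) [0..<m] x 0 = m" if "m \<le> n" for m
    using that by (induction m) (use assms in auto)
  then show ?thesis by simp
qed

lemma exec_com_of:
  assumes "loops_ok p" "''n'' \<notin> assigned p" "s ''n'' 0 = n"
  shows "\<exists>t \<le> poly (cost p) n. exec (com_of p) s t (run n p s)"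
  using assms
proof (induction p arbitrary: s)
  case Nop
  then show ?case using exec.Skip by fastforce
next
  case (Put x i a)
  have "exec (Assign x i a) s 1 (upd s x (aval i s) (aval a s))"
    unfolding upd_def by (rule exec.Assign)
  then have "exec (com_of (Put x i a)) s 1 (run n (Put x i a) s)"
    by (simp only: com_of.simps run.simps)
  then show ?case by (intro exI[of _ 1]) (simp del: com_of.simps run.simps)
next
  case (Then p q)
  then obtain t where t: "t \<le> poly (cost p) n" "exec (com_of p) s t (run n p s)" by auto
  obtain t' where "t' \<le> poly (cost q) n" "exec (com_of q) (run n p s) t' (run n q (run n p s))"
    using Then.IH(2)[of "run n p s"] Then.prems by (auto simp: run_frame)
  then show ?case using t exec.Seq by (fastforce intro!: exI[of _ "t + t'"])
next
  case (Branch b p q)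
  show ?case
  proof (cases "bval b s")
    case True
    then obtain t where "t \<le> poly (cost p) n" "exec (com_of p) s t (run n p s)" using Branch by auto
    then show ?thesis using True exec.CondTrue by (fastforce intro!: exI[of _ "1 + t"])
  next
    case False
    then obtain t where "t \<le> poly (cost q) n" "exec (com_of q) s t (run n q s)" using Branch by auto
    then show ?thesis using False exec.CondFalse by (fastforce intro!: exI[of _ "1 + t"])
  qed
next
  case (For x p)
  let ?F = "\<lambda>s i. upd (run n p s) x 0 (Suc i)" and ?b = "Less (Var x) (Var ''n'')"
    and ?c = "Seq (com_of p) (Assign x (Const 0) (Plus (Var x) (Const 1)))"
  have x: "x \<noteq> ''n''" "x \<notin> assigned p" "''n'' \<notin> assigned p" using For.prems by auto
  \<comment> \<open>Induction on the number \<open>k\<close> of rounds left, when the counter holds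
    \<open>n - k\<close>; the summand 1 pays for the failing test.\<close>
  have "\<exists>t \<le> 1 + k * (poly (cost p) n + 2). exec (While ?b ?c) s t (foldl ?F s [n - k..<n])"
    if "k \<le> n" "s x 0 = n - k" "s ''n'' 0 = n" for k s
    using that
  proof (induction k arbitrary: s)
    case 0
    then show ?case using exec.WhileFalse[of ?b s ?c] by auto
  next
    case (Suc k)
    let ?s = "?F s (n - Suc k)"
    obtain t where t: "t \<le> poly (cost p) n" "exec (com_of p) s t (run n p s)"
      using For.IH For.prems x Suc.prems by auto
    have c: "exec ?c s (t + 1) ?s"
      using exec.Seq[OF t(2) exec.Assign[of x "Const 0" "Plus (Var x) (Const 1)"]] x Suc.prems
      by (simp add: upd_def run_frame)
    have "k \<le> n" "?s x 0 = n - k" "?s ''n'' 0 = n"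
      using Suc.prems x by (auto simp: run_frame Suc_diff_Suc)
    from Suc.IH[of ?s, OF this] obtain t' where t': "t' \<le> 1 + k * (poly (cost p) n + 2)"
        "exec (While ?b ?c) ?s t' (foldl ?F ?s [n - k..<n])" by blast
    have upt: "[n - Suc k..<n] = (n - Suc k) # [n - k..<n]"
      using Suc.prems by (simp add: upt_conv_Cons Suc_diff_Suc)
    have "bval ?b s" using Suc.prems by simp
    from exec.WhileTrue[OF this c t'(2)]
    have "exec (While ?b ?c) s (1 + (t + 1) + t') (foldl ?F s [n - Suc k..<n])"
      by (simp only: upt foldl.simps)
    moreover have "1 + (t + 1) + t' \<le> 1 + Suc k * (poly (cost p) n + 2)" using t(1) t'(1) by simp
    ultimately show ?case by blast
  qed
  from this[of n "upd s x 0 0"] obtain t where t: "t \<le> 1 + n * (poly (cost p) n + 2)"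
      "exec (While ?b ?c) (upd s x 0 0) t (foldl ?F (upd s x 0 0) [0..<n])"
    using For.prems x by auto
  have "exec (com_of (For x p)) s (1 + t) (run n (For x p) s)"
    using exec.Seq[OF exec.Assign[of x "Const 0" "Const 0" s], of "While ?b ?c" t] t(2) by (simp add: upd_def)
  moreover have "1 + t \<le> poly (cost (For x p)) n" using t(1) by (simp add: algebra_simps)
  ultimately show ?case by blast
qed

section \<open>Computing a removal ordering\<close>

abbreviation Is_zero :: "aexp \<Rightarrow> bexp" where
  "Is_zero a \<equiv> Less a (Const 1)"

abbreviation Is_pos :: "aexp \<Rightarrow> bexp" where
  "Is_pos a \<equiv> Less (Const 0) a"

text \<open>
  The array \<open>r\<close> flags the vertices removed so far, and \<open>m\<close> those reached by the current search among
  the others. Since there is no multiplication, \<open>e\<close> and \<open>g\<close> keep the offsets of the rows of \<open>x\<close>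
  and \<open>v\<close> in the adjacency matrix. The outcome of \<open>test\<close>, which temporarily has \<open>v\<close> removed, is
  positive iff \<open>d < 3\<close>.
\<close>

definition spread :: prog where
  "spread = Put ''e'' (Const 0) (Const 0) ;;
     For ''x'' (For ''y'' (Branch
         (Conj (Conj (Is_zero (Cell ''r'' (Var ''x''))) (Is_pos (Cell ''m'' (Var ''x''))))
           (Conj (Is_zero (Cell ''r'' (Var ''y''))) (Is_pos (Cell ''adj'' (Plus (Var ''e'') (Var ''y''))))))
         (Put ''m'' (Var ''y'') (Const 1)) Nop) ;;
       Put ''e'' (Const 0) (Plus (Var ''e'') (Var ''n'')))"

text \<open>The search starts from the last vertex not removed; \<open>n\<close> rounds of
  \<open>spread\<close> suffice to close the marked set.\<close>

definition search :: prog where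
  "search = For ''w'' (Put ''m'' (Var ''w'') (Const 0)) ;;
     For ''w'' (Branch (Is_zero (Cell ''r'' (Var ''w''))) (Put ''q'' (Const 0) (Var ''w'')) Nop) ;;
     Put ''m'' (Var ''q'') (Const 1) ;; For ''j'' spread"

definition count :: prog where
  "count = Put ''d'' (Const 0) (Const 0) ;;
     For ''w'' (Branch (Conj (Is_zero (Cell ''r'' (Var ''w''))) (Is_pos (Cell ''adj'' (Plus (Var ''g'') (Var ''w'')))))
       (Put ''d'' (Const 0) (Plus (Var ''d'') (Const 1))) Nop)"

text \<open>An unreached vertex overwrites the degree by 3, so one comparison checks both
  connectedness and the degree bound.\<close>

definition test :: prog where
  "test = search ;; count ;;
     For ''w'' (Branch (Conj (Is_zero (Cell ''r'' (Var ''w''))) (Is_zero (Cell ''m'' (Var ''w''))))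
       (Put ''d'' (Const 0) (Const 3)) Nop)"

text \<open>\<open>v\<close> is flagged only during its own test, which concerns the graph without
  it; \<open>c\<close> keeps the last vertex that passes.\<close>

definition select :: prog where
  "select = Put ''g'' (Const 0) (Const 0) ;;
     For ''v'' (Branch (Is_zero (Cell ''r'' (Var ''v'')))
         (Put ''r'' (Var ''v'') (Const 1) ;; test ;;
          Branch (Less (Var ''d'') (Const 3)) (Put ''c'' (Const 0) (Var ''v'')) Nop ;;
          Put ''r'' (Var ''v'') (Const 0)) Nop ;;
       Put ''g'' (Const 0) (Plus (Var ''g'') (Var ''n'')))"

text \<open>\<open>out\<close> is filled from cell \<open>n - 1\<close> downwards, which reverses
  the order of removal.\<close>

definition order_program :: prog where
  "order_program = For ''k'' (select ;; Put ''r'' (Var ''c'') (Const 1) ;;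
     Put ''out'' (Minus (Var ''n'') (Plus (Var ''k'') (Const 1))) (Var ''c''))"

lemmas assigned_programs =
  spread_def search_def count_def test_def select_def order_program_def

lemma loops_ok_order_program: "loops_ok order_program" "''n'' \<notin> assigned order_program"
  by (simp_all add: assigned_programs)

section \<open>Correctness of the program\<close>

definition alive :: "nat \<Rightarrow> store \<Rightarrow> nat set" where
  "alive n s = {w. w < n \<and> s ''r'' w = 0}"

definition marked :: "nat \<Rightarrow> store \<Rightarrow> nat set" where
  "marked n s = {w \<in> alive n s. 0 < s ''m'' w}"

lemma finite_alive [simp]: "finite (alive n s)" "finite (marked n s)"
  by (simp_all add: alive_def marked_def)

lemma alive_cong: "s ''r'' = s' ''r'' \<Longrightarrow> alive n s = alive n s'"
  by (simp add: alive_def)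

lemma alive_upd [simp]: "x \<noteq> ''r'' \<Longrightarrow> alive n (upd s x i a) = alive n s"
  by (simp add: alive_def)

lemma marked_upd [simp]: "x \<noteq> ''r'' \<Longrightarrow> x \<noteq> ''m'' \<Longrightarrow> marked n (upd s x i a) = marked n s"
  by (simp add: marked_def)

lemma marked_upd_m [simp]:
  "y \<in> alive n s \<Longrightarrow> 0 < a \<Longrightarrow> marked n (upd s ''m'' y a) = insert y (marked n s)"
  by (auto simp: marked_def)

lemma marked_subset_alive: "marked n s \<subseteq> alive n s"
  by (auto simp: marked_def)

locale stored_relation =
  fixes n :: nat and E :: "nat rel"
  assumes symE: "sym E"
begin

definition input :: "store \<Rightarrow> bool" where
  "input s \<longleftrightarrow> s ''n'' 0 = n \<and> (\<forall>x<n. \<forall>y<n. 0 < s ''adj'' (x * n + y) \<longleftrightarrow> (x, y) \<in> E)"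

lemma input_upd [simp]: "x \<noteq> ''n'' \<Longrightarrow> x \<noteq> ''adj'' \<Longrightarrow> input (upd s x i a) \<longleftrightarrow> input s"
  by (simp add: input_def)

lemma input_run: "''n'' \<notin> assigned p \<Longrightarrow> ''adj'' \<notin> assigned p \<Longrightarrow> input (run n p s) \<longleftrightarrow> input s"
  by (simp add: input_def run_frame)

text \<open>Marks made during a pass may spread further in the same pass, so the new marked set is
  only bounded from below. It stays connected because each new mark is adjacent to an earlier
  one.\<close>

lemma run_spread:
  assumes "input s"
  defines "s' \<equiv> run n spread s"
  shows "marked n s \<subseteq> marked n s'"
    and "cut_connected E (marked n s) \<Longrightarrow> cut_connected E (marked n s')"
    and "x \<in> marked n s \<Longrightarrow> y \<in> alive n s \<Longrightarrow> (x, y) \<in> E \<Longrightarrow> y \<in> marked n s'"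
proof -
  let ?A = "alive n s" and ?M = "marked n s"
  define ext where "ext t \<longleftrightarrow> input t \<and> alive n t = ?A \<and> ?M \<subseteq> marked n t \<and>
    (cut_connected E ?M \<longrightarrow> cut_connected E (marked n t))" for t
  have ext_upd: "ext (upd t z i a) \<longleftrightarrow> ext t" if "z \<notin> {''n'', ''adj'', ''r'', ''m''}" for t z i a
    using that by (simp add: ext_def)
  \<comment> \<open>\<open>I i\<close>: the rows below \<open>i\<close> are done.
    \<open>J x j\<close>: in addition, row \<open>x\<close> is done for the columns below
    \<open>j\<close>. Only neighbours of the initial marks \<open>?M\<close> are promised.\<close>
  define I where "I i t \<longleftrightarrow> ext t \<and> t ''e'' 0 = i * n \<and>
    (\<forall>x\<in>?M. \<forall>y\<in>?A. x < i \<and> (x, y) \<in> E \<longrightarrow> y \<in> marked n t)" for i t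
  define J where "J x j t \<longleftrightarrow> I x t \<and> t ''x'' 0 = x \<and>
    (x \<in> ?M \<longrightarrow> (\<forall>y\<in>?A. y < j \<and> (x, y) \<in> E \<longrightarrow> y \<in> marked n t))" for x j t
  let ?inner = "Branch
         (Conj (Conj (Is_zero (Cell ''r'' (Var ''x''))) (Is_pos (Cell ''m'' (Var ''x''))))
           (Conj (Is_zero (Cell ''r'' (Var ''y''))) (Is_pos (Cell ''adj'' (Plus (Var ''e'') (Var ''y''))))))
         (Put ''m'' (Var ''y'') (Const 1)) Nop"
  have inner: "J x n (run n (For ''y'' ?inner) t)" if x: "x < n" and t: "I x t" "t ''x'' 0 = x" for x t
  proof (rule run_For)
    show "J x 0 (upd t ''y'' 0 0)" using t by (simp add: J_def I_def ext_upd)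
  next
    fix y t assume y: "y < n" and J: "J x y t" and ty: "t ''y'' 0 = y"
    have tt: "t ''x'' 0 = x" "t ''e'' 0 = x * n" "input t" "alive n t = ?A"
      using J by (auto simp: J_def I_def ext_def)
    let ?c = "x \<in> marked n t \<and> y \<in> ?A \<and> (x, y) \<in> E"
    have "run n ?inner t = (if ?c then upd t ''m'' y 1 else t)"
      using tt(3) x y unfolding tt(4)[symmetric]
      by (auto simp: tt(1,2) ty marked_def alive_def input_def)
    moreover have "J x (Suc y) (if ?c then upd t ''m'' y 1 else t)"
    proof (cases ?c)
      case True
      have "cut_connected E (marked n t) \<Longrightarrow> cut_connected E (insert y (marked n t))"
        using cut_connected_insert[OF symE] True by blast
      then show ?thesis using J True by (auto simp: J_def I_def ext_def less_Suc_eq)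
    next
      case False
      moreover have "?M \<subseteq> marked n t" using J by (auto simp: J_def I_def ext_def)
      ultimately show ?thesis using J by (auto simp: J_def less_Suc_eq)
    qed
    ultimately show "J x (Suc y) (upd (run n ?inner t) ''y'' 0 (Suc y))"
      by (simp add: J_def I_def ext_upd del: run.simps)
  qed
  have "I n s'"
    unfolding s'_def spread_def run.simps(3)
  proof (rule run_For)
    show "I 0 (upd (run n (Put ''e'' (Const 0) (Const 0)) s) ''x'' 0 0)"
      using assms by (simp add: I_def ext_def)
  next
    fix x t assume x: "x < n" and t: "I x t" "t ''x'' 0 = x"
    let ?t = "run n (For ''y'' ?inner) t"
    have J: "J x n ?t" using inner[OF x t] .
    then have e: "?t ''e'' 0 = x * n" "?t ''n'' 0 = n" by (auto simp: J_def I_def ext_def input_def)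
    have "I (Suc x) (upd (upd ?t ''e'' 0 (x * n + n)) ''x'' 0 (Suc x))"
      using J by (auto simp: J_def I_def ext_upd less_Suc_eq alive_def simp del: run.simps)
    then show "I (Suc x) (upd (run n (For ''y'' ?inner ;; Put ''e'' (Const 0) (Plus (Var ''e'') (Var ''n''))) t) ''x'' 0 (Suc x))"
      unfolding run.simps(3) run.simps(2) by (simp only: e aval.simps)
  qed
  moreover have less_n: "x < n" if "x \<in> ?M" for x using that by (simp add: marked_def alive_def)
  ultimately show "?M \<subseteq> marked n s'" "cut_connected E ?M \<Longrightarrow> cut_connected E (marked n s')"
    "x \<in> ?M \<Longrightarrow> y \<in> ?A \<Longrightarrow> (x, y) \<in> E \<Longrightarrow> y \<in> marked n s'"
    using less_n by (auto simp: I_def ext_def)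
qed

text \<open>The final marked set is connected and closed under neighbours, hence it is everything
  exactly if the remaining graph is connected.\<close>

lemma run_search:
  assumes "input s"
  shows "marked n (run n search s) = alive n s \<longleftrightarrow> cut_connected E (alive n s)"
proof -
  let ?A = "alive n s"
  define s1 where "s1 = run n (For ''w'' (Put ''m'' (Var ''w'') (Const 0))) s"
  define s2 where "s2 = run n (For ''w'' (Branch (Is_zero (Cell ''r'' (Var ''w''))) (Put ''q'' (Const 0) (Var ''w'')) Nop)) s1"
  define s3 where "s3 = upd s2 ''m'' (s2 ''q'' 0) 1"
  have "(\<lambda>i t. \<forall>w<i. t ''m'' w = 0) n s1"
    unfolding s1_def by (rule run_For) (auto simp: less_Suc_eq)
  moreover have "s2 ''m'' = s1 ''m''" unfolding s2_def by (simp add: run_frame del: run.simps)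
  ultimately have m2: "s2 ''m'' w = 0" if "w < n" for w using that by simp
  have r1: "s1 ''r'' = s ''r''" "s1 ''adj'' = s ''adj''" "s1 ''n'' = s ''n''"
    unfolding s1_def by (simp_all add: run_frame del: run.simps)
  define Q where "Q i t \<longleftrightarrow> t ''r'' = s ''r'' \<and> ((\<exists>w\<in>?A. w < i) \<longrightarrow> t ''q'' 0 \<in> ?A)" for i :: nat and t :: store
  have "Q n s2"
    unfolding s2_def
  proof (rule run_For)
    fix i t assume "i < n" "Q i t" "t ''w'' 0 = i"
    then show "Q (Suc i) (upd (run n (Branch (Is_zero (Cell ''r'' (Var ''w''))) (Put ''q'' (Const 0) (Var ''w'')) Nop) t) ''w'' 0 (Suc i))"
      by (auto simp: Q_def upd_other less_Suc_eq alive_def)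
  qed (simp add: Q_def r1 upd_other)
  then have q: "s2 ''q'' 0 \<in> ?A" if "?A \<noteq> {}" using that by (auto simp: Q_def alive_def)
  have r2: "s2 ''r'' = s ''r''" "s2 ''adj'' = s ''adj''" "s2 ''n'' = s ''n''"
    using r1 unfolding s2_def by (simp_all add: run_frame del: run.simps)
  have r3: "alive n s3 = ?A" "input s3"
    using assms r2 by (auto simp: s3_def alive_def input_def)
  \<comment> \<open>With no vertex left, \<open>q\<close> holds a stale value, but a mark there is
    not counted by \<open>marked\<close>.\<close>
  have M3: "marked n s3 = (if ?A = {} then {} else {s2 ''q'' 0})"
    using m2 q r2 r3(1) by (auto simp: s3_def marked_def alive_def)
  \<comment> \<open>Every round of \<open>spread\<close> marks a new vertex unless the marked set is already closed.\<close>
  define I where "I i t \<longleftrightarrow> input t \<and> alive n t = ?A \<and> cut_connected E (marked n t) \<and>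
    (?A \<noteq> {} \<longrightarrow> marked n t \<noteq> {}) \<and>
    ((\<forall>x\<in>marked n t. \<forall>y\<in>?A. (x, y) \<in> E \<longrightarrow> y \<in> marked n t) \<or> i < card (marked n t))" for i t
  let ?t = "run n (For ''j'' spread) s3"
  have "I n ?t"
  proof (rule run_For)
    show "I 0 (upd s3 ''j'' 0 0)" using r3 M3 by (auto simp: I_def)
  next
    fix i t assume I: "I i t"
    then have t: "input t" "alive n t = ?A" by (auto simp: I_def)
    note s = run_spread[OF t(1)]
    let ?u = "run n spread t"
    have r: "alive n ?u = ?A" unfolding t(2)[symmetric] by (rule alive_cong) (simp add: run_frame spread_def del: run.simps)
    have c: "cut_connected E (marked n ?u)" using s(2) I by (auto simp: I_def)
    have inp: "input ?u" using t(1) by (simp add: input_run spread_def del: run.simps)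
    have "(\<forall>x\<in>marked n ?u. \<forall>y\<in>?A. (x, y) \<in> E \<longrightarrow> y \<in> marked n ?u) \<or> Suc i < card (marked n ?u)"
    proof (cases "marked n ?u = marked n t")
      case True
      then show ?thesis using s(3) t(2) by auto
    next
      case False
      \<comment> \<open>Had the old marks been closed already, the connected set of new marks would
        contain an edge leaving the old ones, which is impossible.\<close>
      have "i < card (marked n t)"
      proof (rule ccontr)
        assume "\<not> ?thesis"
        then have cl: "\<forall>x\<in>marked n t. \<forall>y\<in>?A. (x, y) \<in> E \<longrightarrow> y \<in> marked n t" using I by (auto simp: I_def)
        have "marked n t \<noteq> {}"
          using I False r marked_subset_alive[of n ?u] t(2) s(1) by (auto simp: I_def)
        then obtain x y where "x \<in> marked n t" "y \<in> marked n ?u - marked n t" "(x, y) \<in> E"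
          using cut_connectedE[OF c s(1)] False by metis
        then show False using cl r marked_subset_alive[of n ?u] by blast
      qed
      moreover have "card (marked n t) < card (marked n ?u)"
        using False s(1) by (intro psubset_card_mono) auto
      ultimately show ?thesis by simp
    qed
    then show "I (Suc i) (upd ?u ''j'' 0 (Suc i))" using c r inp I s(1) by (auto simp: I_def)
  qed
  moreover have t_def: "run n search s = ?t"
    unfolding search_def run.simps(3) s3_def s2_def s1_def by (simp del: run.simps(4,5))
  \<comment> \<open>This excludes the second alternative in \<open>I n\<close>, so the marked set is
    closed in the end.\<close>
  moreover have "card (marked n ?t) \<le> n"
    using card_mono[of "{..<n}" "marked n ?t"] by (force simp: marked_def alive_def)
  ultimately have cl: "\<And>x y. x \<in> marked n ?t \<Longrightarrow> y \<in> ?A \<Longrightarrow> (x, y) \<in> E \<Longrightarrow> y \<in> marked n ?t"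
    and conn: "cut_connected E (marked n ?t)" and ne: "?A \<noteq> {} \<Longrightarrow> marked n ?t \<noteq> {}"
    and sub: "marked n ?t \<subseteq> ?A"
    using marked_subset_alive[of n ?t] by (auto simp: I_def)
  show ?thesis
    unfolding t_def
  proof
    assume A: "cut_connected E ?A"
    show "marked n ?t = ?A"
    proof (rule ccontr)
      assume ne': "marked n ?t \<noteq> ?A"
      then have "marked n ?t \<noteq> {}" using ne by metis
      then obtain x y where "x \<in> marked n ?t" "y \<in> ?A - marked n ?t" "(x, y) \<in> E"
        using cut_connectedE[OF A sub] ne' by metis
      then show False using cl by blast
    qed
  qed (use conn in metis)
qed

lemma run_count:
  assumes "input s" "v < n" "s ''g'' 0 = v * n"
  shows "run n count s ''d'' 0 = card {w \<in> alive n s. (v, w) \<in> E}"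
proof -
  let ?A = "alive n s"
  let ?body = "Branch (Conj (Is_zero (Cell ''r'' (Var ''w''))) (Is_pos (Cell ''adj'' (Plus (Var ''g'') (Var ''w'')))))
       (Put ''d'' (Const 0) (Plus (Var ''d'') (Const 1))) Nop"
  define I where "I i t \<longleftrightarrow> input t \<and> t ''r'' = s ''r'' \<and> t ''g'' 0 = v * n \<and>
    t ''d'' 0 = card {w \<in> ?A. (v, w) \<in> E \<and> w < i}" for i t
  have "I n (run n count s)"
    unfolding count_def run.simps(3)
  proof (rule run_For)
    show "I 0 (upd (run n (Put ''d'' (Const 0) (Const 0)) s) ''w'' 0 0)"
      using assms by (simp add: I_def upd_other)
  next
    fix i t assume i: "i < n" and I: "I i t" and w: "t ''w'' 0 = i"
    have "run n ?body t = (if i \<in> ?A \<and> (v, i) \<in> E then upd t ''d'' 0 (Suc (t ''d'' 0)) else t)"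
      using I i assms(2) by (auto simp: I_def w alive_def input_def)
    moreover have "{w \<in> ?A. (v, w) \<in> E \<and> w < Suc i} = (if i \<in> ?A \<and> (v, i) \<in> E
        then insert i {w \<in> ?A. (v, w) \<in> E \<and> w < i} else {w \<in> ?A. (v, w) \<in> E \<and> w < i})"
      by (auto simp: less_Suc_eq)
    ultimately show "I (Suc i) (upd (run n ?body t) ''w'' 0 (Suc i))"
      using I by (simp add: I_def upd_other del: run.simps)
  qed
  moreover have "{w \<in> ?A. (v, w) \<in> E \<and> w < n} = {w \<in> ?A. (v, w) \<in> E}" by (auto simp: alive_def)
  ultimately show ?thesis by (simp add: I_def)
qed

lemma run_test:
  assumes "input s" "v < n" "s ''g'' 0 = v * n"
  shows "run n test s ''d'' 0 < 3 \<longleftrightarrow>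
    cut_connected E (alive n s) \<and> card {w \<in> alive n s. (v, w) \<in> E} \<le> 2"
proof -
  let ?body = "Branch (Conj (Is_zero (Cell ''r'' (Var ''w''))) (Is_zero (Cell ''m'' (Var ''w''))))
       (Put ''d'' (Const 0) (Const 3)) Nop"
  let ?s = "run n search s"
  let ?t = "run n count ?s"
  have s: "input ?s" "?s ''g'' 0 = v * n" "?s ''r'' = s ''r''"
    using assms by (simp_all add: input_run run_frame assigned_programs del: run.simps)
  have d: "?t ''d'' 0 = card {w \<in> alive n s. (v, w) \<in> E}"
    using run_count[OF s(1) assms(2) s(2)] s(3) by (simp add: alive_def)
  have t: "?t ''r'' = s ''r''" "?t ''m'' = ?s ''m''"
    using s(3) by (simp_all add: run_frame count_def del: run.simps)
  have mt: "marked n ?t = marked n ?s" using t s(3) by (simp add: marked_def alive_def)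
  have at: "alive n ?t = alive n s" using t by (simp add: alive_def)
  define I where "I i u \<longleftrightarrow> u ''r'' = ?t ''r'' \<and> u ''m'' = ?t ''m'' \<and>
    (u ''d'' 0 < 3 \<longleftrightarrow> ?t ''d'' 0 < 3 \<and> (\<forall>w \<in> alive n ?t. w < i \<longrightarrow> w \<in> marked n ?t))" for i u
  have "I n (run n test s)"
    unfolding test_def run.simps(3)
  proof (rule run_For)
    fix i u assume "i < n" "I i u" "u ''w'' 0 = i"
    then show "I (Suc i) (upd (run n ?body u) ''w'' 0 (Suc i))"
      by (auto simp: I_def upd_other less_Suc_eq alive_def marked_def)
  qed (simp add: I_def upd_other)
  then have "run n test s ''d'' 0 < 3 \<longleftrightarrow> ?t ''d'' 0 < 3 \<and> marked n ?t = alive n ?t"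
    by (auto simp: I_def alive_def marked_def)
  then show ?thesis using d run_search[OF assms(1)] mt at by auto
qed

definition removable :: "nat set \<Rightarrow> nat \<Rightarrow> bool" where
  "removable A v \<longleftrightarrow> v \<in> A \<and> cut_connected E (A - {v}) \<and> card {w \<in> A - {v}. (v, w) \<in> E} \<le> 2"

lemma test_frame: "assigned test = {''w'', ''m'', ''q'', ''j'', ''e'', ''x'', ''y'', ''d''}"
  by (auto simp: assigned_programs)

text \<open>That a removable vertex exists ensures that \<open>c\<close> is assigned during this
  pass, so no stale value is returned.\<close>

lemma run_select:
  assumes "input s" "removable (alive n s) v"
  defines "s' \<equiv> run n select s"
  shows "s' ''r'' = s ''r''" "removable (alive n s) (s' ''c'' 0)"
proof -
  let ?A = "alive n s"
  define I where "I i t \<longleftrightarrow> input t \<and> t ''r'' = s ''r'' \<and> t ''g'' 0 = i * n \<and>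
    ((\<exists>v<i. removable ?A v) \<longrightarrow> removable ?A (t ''c'' 0))" for i t
  let ?body = "Branch (Is_zero (Cell ''r'' (Var ''v'')))
         (Put ''r'' (Var ''v'') (Const 1) ;; test ;;
          Branch (Less (Var ''d'') (Const 3)) (Put ''c'' (Const 0) (Var ''v'')) Nop ;;
          Put ''r'' (Var ''v'') (Const 0)) Nop"
  have "I n s'"
    unfolding s'_def select_def run.simps(3)
  proof (rule run_For)
    show "I 0 (upd (run n (Put ''g'' (Const 0) (Const 0)) s) ''v'' 0 0)"
      using assms by (simp add: I_def upd_other)
  next
    fix i t assume i: "i < n" and I: "I i t" and v: "t ''v'' 0 = i"
    have body: "input (run n ?body t) \<and> run n ?body t ''r'' = s ''r'' \<and> run n ?body t ''g'' 0 = i * n \<and>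
      (run n ?body t ''c'' 0 = (if removable ?A i then i else t ''c'' 0))"
    proof (cases "i \<in> ?A")
      case False
      then have "\<not> bval (Is_zero (Cell ''r'' (Var ''v''))) t" using I i v by (auto simp: I_def alive_def)
      then have "run n ?body t = t" by simp
      then show ?thesis using False I by (auto simp: I_def removable_def)
    next
      case True
      define t1 where "t1 = upd t ''r'' i 1"
      define t2 where "t2 = run n test t1"
      define t3 where "t3 = (if t2 ''d'' 0 < 3 then upd t2 ''c'' 0 i else t2)"
      have f: "t2 y = t1 y" if "y \<in> {''v'', ''c'', ''r'', ''g''}" for y
        using that unfolding t2_def by (intro run_frame) (auto simp: test_frame)
      have t1: "input t1" "t1 ''g'' 0 = i * n" "alive n t1 = ?A - {i}"
        using I by (auto simp: t1_def I_def alive_def)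
      have d: "t2 ''d'' 0 < 3 \<longleftrightarrow> removable ?A i"
        using run_test[OF t1(1) i t1(2)] True by (simp add: t2_def t1(3) removable_def)
      have "bval (Is_zero (Cell ''r'' (Var ''v''))) t" using True I v by (auto simp: I_def alive_def)
      then have "run n ?body t = run n (Put ''r'' (Var ''v'') (Const 1) ;; test ;;
          Branch (Less (Var ''d'') (Const 3)) (Put ''c'' (Const 0) (Var ''v'')) Nop ;;
          Put ''r'' (Var ''v'') (Const 0)) t" by (simp only: run.simps(4) if_True)
      also have "\<dots> = upd t3 ''r'' i 0"
      proof -
        have "t2 ''v'' 0 = i" using f v by (simp add: t1_def)
        then have "run n (Branch (Less (Var ''d'') (Const 3)) (Put ''c'' (Const 0) (Var ''v'')) Nop) t2 = t3"
          "run n (Put ''r'' (Var ''v'') (Const 0)) t3 = upd t3 ''r'' i 0"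
          by (simp_all add: t3_def)
        moreover have "run n (Put ''r'' (Var ''v'') (Const 1)) t = t1" by (simp add: t1_def v)
        ultimately show ?thesis by (simp only: run.simps(3) t2_def)
      qed
      finally have body: "run n ?body t = upd t3 ''r'' i 0" .
      have "input t2" using t1(1) unfolding t2_def by (simp add: test_frame input_run)
      moreover have "t2 ''g'' 0 = i * n" "t2 ''c'' 0 = t ''c'' 0"
        using t1(2) f by (auto simp: t1_def)
      ultimately have "input (upd t3 ''r'' i 0)" "upd t3 ''r'' i 0 ''g'' 0 = i * n"
        "upd t3 ''r'' i 0 ''c'' 0 = (if removable ?A i then i else t ''c'' 0)"
        using d by (simp_all add: t3_def)
      \<comment> \<open>Cell \<open>i\<close> was 0 before, \<open>i\<close> being alive, so
        resetting it to 0 restores the whole array.\<close>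
      moreover have "upd t3 ''r'' i 0 ''r'' = s ''r''"
      proof
        fix j
        have "t3 ''r'' j = t1 ''r'' j" using f[of "''r''"] by (simp add: t3_def)
        then show "upd t3 ''r'' i 0 ''r'' j = s ''r'' j"
          using True I by (simp add: t1_def I_def alive_def)
      qed
      ultimately show ?thesis unfolding body by blast
    qed
    then have "run n ?body t ''n'' 0 = n" by (auto simp: input_def)
    then have "run n (?body ;; Put ''g'' (Const 0) (Plus (Var ''g'') (Var ''n''))) t = upd (run n ?body t) ''g'' 0 (i * n + n)"
      using body by (simp only: run.simps(2,3) aval.simps)
    then show "I (Suc i) (upd (run n (?body ;; Put ''g'' (Const 0) (Plus (Var ''g'') (Var ''n''))) t) ''v'' 0 (Suc i))"
      using body I by (auto simp: I_def upd_other less_Suc_eq simp del: run.simps)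
  qed
  then show "s' ''r'' = s ''r''" "removable (alive n s) (s' ''c'' 0)"
    using assms(2) by (auto simp: I_def removable_def alive_def)
qed

end

text \<open>The invariant says that the part of \<open>out\<close> already written completes every
  removal ordering of the remaining vertices. Once none remain, it is applied to the empty
  list.\<close>

lemma run_order_program:
  assumes G: "pair_graph G" "pverts G = {..<n}" "K4_minor_free G" "connected_graph G"
  shows "removal_ordering G (output_list n (run n order_program (graph_store n G)))"
    and "set (output_list n (run n order_program (graph_store n G))) = {..<n}"
proof -
  interpret stored_relation n "parcs G"
    using pair_graphD(3)[OF G(1)] by unfold_locales
  let ?s = "graph_store n G"
  let ?body = "select ;; Put ''r'' (Var ''c'') (Const 1) ;;
     Put ''out'' (Minus (Var ''n'') (Plus (Var ''k'') (Const 1))) (Var ''c'')"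
  define I where "I i t \<longleftrightarrow> input t \<and> cut_connected (parcs G) (alive n t) \<and> card (alive n t) + i = n \<and>
    set (map (t ''out'') [n - i..<n]) = {..<n} - alive n t \<and>
    (\<forall>xs. removal_ordering G xs \<and> set xs = alive n t \<longrightarrow>
      removal_ordering G (xs @ map (t ''out'') [n - i..<n]))" for i t
  have "I n (run n order_program ?s)"
    unfolding order_program_def
  proof (rule run_For)
    have "input ?s" by (auto simp: input_def graph_store_def)
    moreover have "alive n ?s = {..<n}" by (auto simp: alive_def graph_store_def)
    ultimately show "I 0 (upd ?s ''k'' 0 0)"
      using connected_graph_iff[OF G(1)] G(2,4) by (simp add: I_def)
  next
    fix i t assume i: "i < n" and I: "I i t" and k: "t ''k'' 0 = i"
    let ?A = "alive n t"
    let ?u = "run n select t"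
    have inp: "input t" using I by (simp add: I_def)
    have "?A \<noteq> {}" using I i by (auto simp: I_def)
    moreover have "?A \<subseteq> pverts G" by (auto simp: alive_def G(2))
    moreover have "cut_connected (parcs G) ?A" using I by (simp add: I_def)
    ultimately obtain v where "removable ?A v"
      using ex_removable_vertex[OF G(1,3), of ?A] unfolding removable_def by auto
    note sel = run_select[OF inp this]
    define c where "c = ?u ''c'' 0"
    have c: "c \<in> ?A" "cut_connected (parcs G) (?A - {c})" "card {w \<in> ?A - {c}. (c, w) \<in> parcs G} \<le> 2"
      using sel(2) by (auto simp: removable_def c_def)
    have u: "input ?u" "?u ''k'' 0 = i" "?u ''out'' = t ''out''"
      using inp k by (simp_all add: input_run run_frame assigned_programs del: run.simps)
    have "?u ''n'' 0 = n" using u(1) by (simp add: input_def)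
    then have run: "run n ?body t = upd (upd ?u ''r'' c 1) ''out'' (n - Suc i) c"
      using u(2) by (simp add: c_def)
    let ?t = "upd (upd (upd ?u ''r'' c 1) ''out'' (n - Suc i) c) ''k'' 0 (Suc i)"
    have A': "alive n ?t = ?A - {c}" using sel(1) by (auto simp: alive_def)
    have "[n - Suc i..<n] = (n - Suc i) # [n - i..<n]"
      using i by (simp add: upt_conv_Cons Suc_diff_Suc)
    moreover have "map (?t ''out'') [n - i..<n] = map (t ''out'') [n - i..<n]"
      using u(3) i by auto
    ultimately have out: "map (?t ''out'') [n - Suc i..<n] = c # map (t ''out'') [n - i..<n]" by simp
    have "removal_ordering G (xs @ c # map (t ''out'') [n - i..<n])"
      if xs: "removal_ordering G xs" "set xs = ?A - {c}" for xs
    proof -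
      have "insert c (set xs) = ?A" using xs(2) c(1) by auto
      \<comment> \<open>Putting \<open>c\<close> after an ordering of the rest gives one of
        \<open>?A\<close>, to which the old invariant applies.\<close>
      moreover have "removal_ordering G (xs @ [c])"
        using xs c I calculation by (intro removal_ordering.snoc) (auto simp: I_def)
      ultimately have "removal_ordering G ((xs @ [c]) @ map (t ''out'') [n - i..<n])"
        using I unfolding I_def by auto
      then show ?thesis by simp
    qed
    moreover have "card (?A - {c}) + Suc i = n"
      using I c(1) card_Suc_Diff1[OF _ c(1)] by (simp add: I_def)
    moreover have "insert c ({..<n} - ?A) = {..<n} - (?A - {c})" using c(1) by (auto simp: alive_def)
    ultimately have "I (Suc i) ?t"
      using I c(2) u(1) unfolding I_def out A' by simp
    then show "I (Suc i) (upd (run n ?body t) ''k'' 0 (Suc i))" by (simp only: run)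
  qed
  then have I: "I n (run n order_program ?s)" .
  then have "alive n (run n order_program ?s) = {}" by (simp add: I_def)
  then show "removal_ordering G (output_list n (run n order_program ?s))"
    "set (output_list n (run n order_program ?s)) = {..<n}"
    using I removal_ordering.Nil by (auto simp: I_def output_list_def)
qed

lemma poly_time_good_connected_ordering:
  "poly_time_ordering (\<lambda>G. connected_graph G \<and> K4_minor_free G) good_connected_ordering"
  unfolding poly_time_ordering_def
proof (intro exI[of _ "com_of order_program"] exI[of _ "cost order_program"] allI impI)
  fix n and G :: "nat sgraph"
  assume G: "pair_graph G \<and> pverts G = {..<n} \<and> connected_graph G \<and> K4_minor_free G"
  have "graph_store n G ''n'' 0 = n" by (simp add: graph_store_def)
  then obtain t where "t \<le> poly (cost order_program) n"
      "exec (com_of order_program) (graph_store n G) t (run n order_program (graph_store n G))"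
    using exec_com_of[OF loops_ok_order_program] by blast
  \<comment> \<open>\<open>connected_graph_iff\<close> supplies the nonemptiness of the vertex
    set.\<close>
  moreover have "good_connected_ordering G (output_list n (run n order_program (graph_store n G)))"
    using G run_order_program[of G n] connected_graph_iff[of G]
    by (intro good_connected_ordering_of_removal_ordering) auto
  ultimately show "\<exists>t s. exec (com_of order_program) (graph_store n G) t s \<and>
      t \<le> poly (cost order_program) n \<and> good_connected_ordering G (output_list n s)"
    by blast
qed

theorem theorem5:
  shows "(\<forall>G :: 'a sgraph. pair_graph G \<and> K4_minor_free G \<longrightarrow> \<not> ugly G) \<and>
    (\<forall>G :: 'a sgraph. pair_graph G \<and> connected_graph G \<and> K4_minor_free G \<longrightarrow>
       (\<exists>\<sigma>. good_connected_ordering G \<sigma>)) \<and>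
    poly_time_ordering (\<lambda>G. connected_graph G \<and> K4_minor_free G) good_connected_ordering"
proof (intro conjI allI impI)
  fix G :: "'a sgraph"
  assume "pair_graph G \<and> K4_minor_free G"
  \<comment> \<open>Connectedness is part of \<open>ugly\<close>, so it is available when
    \<open>G\<close> is assumed to be ugly.\<close>
  then show "\<not> ugly G"
    using ex_good_connected_ordering not_ugly_if_good_connected_ordering unfolding ugly_def by metis
qed (use ex_good_connected_ordering poly_time_good_connected_ordering in auto)

end
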